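(* Let $n$ be a positive integer and let $A = A_s + A_d\epsilon$ be an $n\times n$ primitive dual number matrix, i.e. $A_s$ is a real primitive matrix and $A_d$ is a real matrix. Then $A$ has a positive dual number eigenvalue $\lambda = \lambda_s + \lambda_d\epsilon$ and an $n$-dimensional positive dual number eigenvector $\mathbf{x} = \mathbf{x}_s + \mathbf{x}_d\epsilon$ corresponding to $\lambda$. Furthermore, $\lambda_s,\mathbf{x}_s,\lambda_d,\mathbf{x}_d$ have the following properties. (a) $\lambda_s$ is the Perron eigenvalue of $A_s$, with multiplicity $1$. For any other dual complex eigenvalue $\mu = \mu_s+\mu_d\epsilon$ of $A$, we have $\lambda_s > |\mu_s|$. (b) $\mathbf{x}_s$ is the Perron eigenvector of $A_s$. For any eigenvector $\mathbf{z}=\mathbf{z}_s+\mathbf{z}_d\epsilon$ corresponding to another eigenvalue $\mu\neq\lambda$ of $A$, $\mathbf{z}_s$ cannot be a nonnegative vector. (c) We have $$\lambda_d = \frac{\mathbf{y}_s^\top A_d\mathbf{x}_s}{\mathbf{y}_s^\top\mathbf{x}_s},$$ where $\mathbf{y}_s$ is the Perron eigenvector of $A_s^\top$, with $\mathbf{y}_s^\top\mathbf{x}_s>0$. If $A_d$ is nonnegative, then $\lambda_d$ is nonnegative. If $A_d$ is nonnegative and nonzero, then $\lambda_d$ is positive. (d) $\mathbf{x}_d$ is a solution of $$(A_s-\lambda_s I)\mathbf{x}_d = (\lambda_d I - A_d)\mathbf{x}_s .$$ If we require the $2$-norm of $\mathbf{x}$ to be $1$, then $\mathbf{x}_d$ is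 unique. Moreover, writing $A=(a_{ij})$, we have $$\min_i\sum_{j=1}^n a_{ij}\le\lambda\le\max_i\sum_{j=1}^n a_{ij}.$$
   Context: A dual complex number is $a=a_s+a_d\epsilon$ with $a_s,a_d\in\mathbb{C}$ (standard part and dual part), where $\epsilon\ne0$, $\epsilon^2=0$ and $\epsilon$ commutes with complex numbers; it is a dual number if $a_s,a_d\in\mathbb{R}$. Sums and products are $a+b=(a_s+b_s)+(a_d+b_d)\epsilon$, $ab=a_sb_s+(a_sb_d+a_db_s)\epsilon$. Vectors and matrices over these rings are written $\mathbf{x}=\mathbf{x}_s+\mathbf{x}_d\epsilon$, $A=A_s+A_d\epsilon$. Dual numbers are totally ordered by: $a>b$ if $a_s>b_s$, or $a_s=b_s$ and $a_d>b_d$; all inequalities, minima and maxima between dual numbers use this order. A real square matrix $A_s$ is primitive if $A_s\ge O$ entrywise and some power $A_s^m$ ($m\ge1$) is entrywise positive; $A=A_s+A_d\epsilon$ with $A_s$ primitive and $A_d$ an arbitrary real matrix is called a primitive dual number matrix. A dual number vector or matrix is called positive if its standard part is entrywise positive. The Perron eigenvalue of a primitive real matrix is its spectral radius, and its Perron eigenvector is a corresponding entrywise positive real eigenvector. A dual complex number $\lambda$ is an eigenvalue of $A$ with eigenvector $\mathbf{x}$ (a dual complex vector) if $A\mathbf{x}=\lambda\mathbf{x}$ and $\mathbf{x}_s\ne\mathbf{0}$. For $\mathbf{x}_s\neq\mathbf{0}$, the $2$-norm is $\|\mathbf{x}\|_2=\|\mathbf{x}_s\|_2+\frac{\mathbf{x}_s^*\mathbf{x}_d}{\|\mathbf{x}_s\|_2}\epsilon$;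 for real parts, $\|\mathbf{x}\|_2=1$ means $\|\mathbf{x}_s\|_2=1$ and $\mathbf{x}_s^\top\mathbf{x}_d=0$. *)

theory Defs
  imports "Jordan_Normal_Form.Spectral_Radius" "HOL-Library.Nonpos_Ints"
begin

text \<open>
  \<open>Dual a b\<close> stands for \<open>a + b\<epsilon>\<close> with \<open>\<epsilon>\<^sup>2 = 0\<close>. Dual numbers are \<open>real dual_num\<close>,
  dual complex numbers are \<open>complex dual_num\<close>.
\<close>

datatype 'a dual_num = Dual (std_part: 'a) (dual_part: 'a)

instantiation dual_num :: (comm_ring_1) comm_ring_1
begin

definition "0 = Dual 0 0"
definition "1 = Dual 1 0"
definition "a + b = Dual (std_part a + std_part b) (dual_part a + dual_part b)"
definition "- a = Dual (- std_part a) (- dual_part a)"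
definition "a - b = Dual (std_part a - std_part b) (dual_part a - dual_part b)"
definition "a * b =
  Dual (std_part a * std_part b) (std_part a * dual_part b + dual_part a * std_part b)"

instance
  by standard
    (auto simp: zero_dual_num_def one_dual_num_def plus_dual_num_def uminus_dual_num_def
      minus_dual_num_def times_dual_num_def algebra_simps)

end

instantiation dual_num :: (linorder) linorder
begin

definition "a \<le> b \<longleftrightarrow>
  std_part a < std_part b \<or> (std_part a = std_part b \<and> dual_part a \<le> dual_part b)"
definition "a < b \<longleftrightarrow>
  std_part a < std_part b \<or> (std_part a = std_part b \<and> dual_part a < dual_part b)"

instance
  by standard (auto simp: less_eq_dual_num_def less_dual_num_def dual_num.expand)

end

abbreviation complex_of_dual :: "real dual_num \<Rightarrow> complex dual_num" where
  "complex_of_dual \<equiv> map_dual_num complex_of_real"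

abbreviation std_vec :: "'a dual_num vec \<Rightarrow> 'a vec" where
  "std_vec \<equiv> map_vec std_part"

abbreviation dual_vec :: "'a dual_num vec \<Rightarrow> 'a vec" where
  "dual_vec \<equiv> map_vec dual_part"

abbreviation std_mat :: "'a dual_num mat \<Rightarrow> 'a mat" where
  "std_mat \<equiv> map_mat std_part"

abbreviation dual_mat :: "'a dual_num mat \<Rightarrow> 'a mat" where
  "dual_mat \<equiv> map_mat dual_part"

definition mk_dual_vec :: "'a vec \<Rightarrow> 'a vec \<Rightarrow> 'a dual_num vec" where
  "mk_dual_vec u v = vec (dim_vec u) (\<lambda>i. Dual (u $ i) (v $ i))"

text \<open>
  Over the dual complex numbers the library predicate \<open>eigenvector\<close> would be too weak:
  it only asks \<open>x \<noteq> 0\<close>, while here the standard part of \<open>x\<close> must not vanish.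
\<close>

definition dual_eigenvector ::
  "complex dual_num mat \<Rightarrow> complex dual_num vec \<Rightarrow> complex dual_num \<Rightarrow> bool" where
  "dual_eigenvector A x \<mu> \<longleftrightarrow>
     x \<in> carrier_vec (dim_row A) \<and> A *\<^sub>v x = \<mu> \<cdot>\<^sub>v x \<and> std_vec x \<noteq> 0\<^sub>v (dim_row A)"

definition dual_eigenvalue :: "complex dual_num mat \<Rightarrow> complex dual_num \<Rightarrow> bool" where
  "dual_eigenvalue A \<mu> \<longleftrightarrow> (\<exists>x. dual_eigenvector A x \<mu>)"

text \<open>Real dual matrices and vectors are embedded into the dual complex ones.\<close>

definition real_dual_eigenvector ::
  "real dual_num mat \<Rightarrow> real dual_num vec \<Rightarrow> real dual_num \<Rightarrow> bool" where
  "real_dual_eigenvector A x \<mu> \<longleftrightarrow>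
     dual_eigenvector (map_mat complex_of_dual A) (map_vec complex_of_dual x) (complex_of_dual \<mu>)"

definition positive_vec :: "real vec \<Rightarrow> bool" where
  "positive_vec v \<longleftrightarrow> (\<forall>i < dim_vec v. 0 < v $ i)"

definition nonneg_mat :: "real mat \<Rightarrow> bool" where
  "nonneg_mat B \<longleftrightarrow> (\<forall>i < dim_row B. \<forall>j < dim_col B. 0 \<le> B $$ (i, j))"

definition positive_mat :: "real mat \<Rightarrow> bool" where
  "positive_mat B \<longleftrightarrow> (\<forall>i < dim_row B. \<forall>j < dim_col B. 0 < B $$ (i, j))"

definition primitive_mat :: "real mat \<Rightarrow> bool" where
  "primitive_mat B \<longleftrightarrow> square_mat B \<and> nonneg_mat B \<and> (\<exists>m \<ge> 1. positive_mat (B ^\<^sub>m m))"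

definition perron_eigenvalue :: "real mat \<Rightarrow> real" where
  "perron_eigenvalue B = spectral_radius (map_mat complex_of_real B)"

text \<open>Not normalised: every positive multiple of a Perron eigenvector is one, too.\<close>

definition perron_eigenvector :: "real mat \<Rightarrow> real vec \<Rightarrow> bool" where
  "perron_eigenvector B v \<longleftrightarrow> eigenvector B v (perron_eigenvalue B) \<and> positive_vec v"

text \<open>The 2-norm of a real dual vector, meaningful only if its standard part is nonzero.\<close>

definition dual_norm2 :: "real dual_num vec \<Rightarrow> real dual_num" where
  "dual_norm2 x =
     Dual (sqrt (std_vec x \<bullet> std_vec x)) ((std_vec x \<bullet> dual_vec x) / sqrt (std_vec x \<bullet> std_vec x))"

end

theory Submission
  imports Defs
begin

text \<open>
  Write \<open>S\<close> and \<open>D\<close> for the standard and the dual part of \<open>A\<close>. Comparing coefficients,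
  \<open>A x = \<lambda> x\<close> means \<open>S x\<^sub>s = \<lambda>\<^sub>s x\<^sub>s\<close> together with
  \<open>S x\<^sub>d + D x\<^sub>s = \<lambda>\<^sub>s x\<^sub>d + \<lambda>\<^sub>d x\<^sub>s\<close>. The first equation is governed by the
  Perron theory of the primitive matrix \<open>S\<close>, the second one is an inhomogeneous linear system
  for the singular matrix \<open>S - \<lambda>\<^sub>s I\<close>.

  Perron theory rests on one estimate: if \<open>u \<ge> 0\<close> is nonzero and \<open>S u \<ge> r u\<close>, then \<open>r\<close> is at
  most the spectral radius \<open>\<rho>\<close>, for otherwise the powers of \<open>S / s\<close> with
  \<open>\<rho> < s < r\<close> would be bounded and yet stretch \<open>u\<close> without bound
  (\<open>le_perron_eigenvalue_if_expanding\<close>). Hence a nonzero \<open>v \<ge> 0\<close> with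
  \<open>S v \<ge> \<rho> v\<close> must be an eigenvector: a strict inequality somewhere would become a
  strict inequality everywhere after applying a positive power of \<open>S\<close>, and \<open>\<rho>\<close> could be
  enlarged (\<open>superinvariant_imp_perron_eigen\<close>). The vector of absolute values of an eigenvector for
  any eigenvalue of modulus \<open>\<rho>\<close> is such a \<open>v\<close>; this yields existence of a
  positive eigenvector and, through the equality case of the triangle inequality, that \<open>\<rho>\<close> is
  the only eigenvalue on the circle of radius \<open>\<rho>\<close>. Subtracting the largest admissible multiple of
  \<open>x\<^sub>s\<close> shows that the eigenspace is a line, and the positive left eigenvector \<open>y\<close> excludes
  Jordan chains (\<open>perron_eigenvalue_simple\<close>).

  Multiplying the second equation by \<open>y\<^sup>T\<close> cancels \<open>x\<^sub>d\<close> and leaves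
  \<open>\<lambda>\<^sub>d (y \<bullet> x\<^sub>s) = y \<bullet> D x\<^sub>s\<close>. So \<open>\<lambda>\<^sub>d\<close> is forced, also
  for complex eigenvectors: an eigenvalue with standard part \<open>\<rho>\<close> is \<open>\<lambda>\<close> itself. Conversely, this
  condition suffices for solving for \<open>x\<^sub>d\<close> (\<open>perron_fredholm\<close>), uniquely up to multiples
  of \<open>x\<^sub>s\<close>, and a multiple is fixed by \<open>x\<^sub>s \<bullet> x\<^sub>d = 0\<close>.

  Finally, \<open>y\<close> exhibits \<open>\<lambda>\<^sub>s\<close> as a weighted mean of the row sums of \<open>S\<close>; when all of these are
  equal, the all-ones vector is a Perron vector and \<open>\<lambda>\<^sub>d\<close> is the mean of the row sums of \<open>D\<close>
  with the same weights. This is what the bounds in the lexicographic order require.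
\<close>

section \<open>Nonnegative matrices acting on vectors\<close>

text \<open>
  Matrix-vector products are computed as sums over the column index, so the default
  unfolding into scalar products with rows is switched off.
\<close>

declare index_mult_mat_vec [simp del]

lemma mult_mat_vec_sum:
  assumes "A \<in> carrier_mat n k" "v \<in> carrier_vec k" "i < n"
  shows "(A *\<^sub>v v) $ i = (\<Sum>j<k. A $$ (i, j) * v $ j)"
  using assms by (auto simp: index_mult_mat_vec scalar_prod_def atLeast0LessThan intro!: sum.cong)

lemma scalar_prod_sum:
  assumes "w \<in> carrier_vec n"
  shows "v \<bullet> w = (\<Sum>i<n. v $ i * w $ i)"
  using assms by (auto simp: scalar_prod_def atLeast0LessThan)

lemma scalar_prod_mult_transpose:
  fixes A :: "'a :: comm_semiring_0 mat"
  assumes "A \<in> carrier_mat n n" "v \<in> carrier_vec n" "y \<in> carrier_vec n"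
  shows "y \<bullet> (A *\<^sub>v v) = (transpose_mat A *\<^sub>v y) \<bullet> v"
  using assms transpose_vec_mult_scalar[of A n n v y]
  by simp

lemma mult_pow_mat_commute:
  fixes A :: "'a :: semiring_1 mat"
  assumes A: "A \<in> carrier_mat n n"
  shows "A * A ^\<^sub>m k = A ^\<^sub>m k * A"
proof (induction k)
  case (Suc k)
  have "A * (A ^\<^sub>m k * A) = (A * A ^\<^sub>m k) * A"
    using A by (simp add: assoc_mult_mat[of _ n n _ n _ n])
  then show ?case using Suc by simp
qed (use A in simp)

lemma transpose_pow_mat:
  fixes A :: "'a :: comm_semiring_1 mat"
  assumes A: "A \<in> carrier_mat n n"
  shows "transpose_mat (A ^\<^sub>m k) = transpose_mat A ^\<^sub>m k"
proof (induction k)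
  case 0
  then show ?case using A by simp
next
  case (Suc k)
  have "transpose_mat (A ^\<^sub>m Suc k) = transpose_mat A * transpose_mat (A ^\<^sub>m k)"
    using A transpose_mult[of "A ^\<^sub>m k" n n A n] by simp
  also have "\<dots> = transpose_mat A ^\<^sub>m Suc k"
    using Suc.IH A mult_pow_mat_commute[of "transpose_mat A" n k] by simp
  finally show ?case .
qed

lemma nonneg_mult_mat_vec_mono:
  assumes "E \<in> carrier_mat n n" "nonneg_mat E" "v \<in> carrier_vec n" "w \<in> carrier_vec n"
    and "\<And>i. i < n \<Longrightarrow> v $ i \<le> w $ i" "i < n"
  shows "(E *\<^sub>v v) $ i \<le> (E *\<^sub>v w) $ i"
  using assms by (auto simp: mult_mat_vec_sum[of E n n] nonneg_mat_def intro!: sum_mono mult_left_mono)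

lemma nonneg_pow_mat:
  assumes B: "B \<in> carrier_mat n n" and nn: "nonneg_mat B"
  shows "nonneg_mat (B ^\<^sub>m k)"
proof (induction k)
  case 0
  then show ?case by (auto simp: nonneg_mat_def)
next
  case (Suc k)
  then show ?case using B nn
    by (auto simp: nonneg_mat_def scalar_prod_def intro!: sum_nonneg)
qed

lemma positive_mult_mat_vec:
  assumes "E \<in> carrier_mat n n" "positive_mat E" "v \<in> carrier_vec n"
    and "\<And>i. i < n \<Longrightarrow> 0 \<le> v $ i" "v \<noteq> 0\<^sub>v n" "i < n"
  shows "0 < (E *\<^sub>v v) $ i"
proof -
  obtain j where j: "j < n" "v $ j \<noteq> 0" using assms(3,5) by (metis carrier_vecD eq_vecI index_zero_vec)
  have "0 < E $$ (i, j) * v $ j"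
    using assms j by (auto simp: positive_mat_def order_less_le)
  also have "\<dots> \<le> (\<Sum>j<n. E $$ (i, j) * v $ j)"
    using assms j by (intro member_le_sum) (auto simp: positive_mat_def less_imp_le)
  finally show ?thesis using assms by (simp add: mult_mat_vec_sum[of E n n])
qed

lemma scalar_prod_positive:
  fixes y v :: "real vec"
  assumes y: "y \<in> carrier_vec n" "positive_vec y" and v: "v \<in> carrier_vec n"
    and "\<And>i. i < n \<Longrightarrow> 0 \<le> v $ i" "v \<noteq> 0\<^sub>v n"
  shows "0 < y \<bullet> v"
proof -
  obtain j where j: "j < n" "v $ j \<noteq> 0" using v assms(5) by (metis carrier_vecD eq_vecI index_zero_vec)
  have "0 < y $ j * v $ j"
    using assms j by (auto simp: positive_vec_def order_less_le)
  also have "\<dots> \<le> (\<Sum>j<n. y $ j * v $ j)"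
    using assms j by (intro member_le_sum) (auto simp: positive_vec_def less_imp_le)
  finally show ?thesis using assms by (simp add: scalar_prod_sum[of _ n])
qed

section \<open>The spectral radius of a nonnegative matrix\<close>

lemma perron_eigenvalue_ge:
  assumes B: "B \<in> carrier_mat n n" and n: "0 < n"
    and ev: "eigenvalue (map_mat complex_of_real B) \<mu>"
  shows "cmod \<mu> \<le> perron_eigenvalue B"
  unfolding perron_eigenvalue_def
  using spectral_radius_mem_max(2)[of "map_mat complex_of_real B" n] B n ev
  by (auto simp: spectrum_def)

lemma perron_eigenvalue_attained:
  assumes B: "B \<in> carrier_mat n n" and n: "0 < n"
  obtains \<mu> z where "eigenvector (map_mat complex_of_real B) z \<mu>" "cmod \<mu> = perron_eigenvalue B"
  using spectral_radius_mem_max(1)[of "map_mat complex_of_real B" n] B n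
  unfolding perron_eigenvalue_def spectrum_def eigenvalue_def by auto

lemma perron_eigenvalue_smult_less_1:
  assumes B: "B \<in> carrier_mat n n" and n: "0 < n" and s: "perron_eigenvalue B < s" "0 < s"
  shows "perron_eigenvalue ((1 / s) \<cdot>\<^sub>m B) < 1"
proof -
  let ?B = "map_mat complex_of_real B"
  have "(1 / s) \<cdot>\<^sub>m B \<in> carrier_mat n n" using B by simp
  then obtain \<nu> z where z: "eigenvector (map_mat complex_of_real ((1 / s) \<cdot>\<^sub>m B)) z \<nu>"
    and \<nu>: "cmod \<nu> = perron_eigenvalue ((1 / s) \<cdot>\<^sub>m B)"
    using perron_eigenvalue_attained n by blast
  have zc: "z \<in> carrier_vec n" using z B by (auto simp: eigenvector_def)
  have eq: "map_mat complex_of_real ((1 / s) \<cdot>\<^sub>m B) *\<^sub>v z = \<nu> \<cdot>\<^sub>v z" 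
    using z by (simp add: eigenvector_def)
  have "?B *\<^sub>v z = (s * \<nu>) \<cdot>\<^sub>v z"
  proof (rule eq_vecI)
    fix i assume i: "i < dim_vec ((s * \<nu>) \<cdot>\<^sub>v z)"
    then have i: "i < n" using zc by simp
    have "(\<Sum>j<n. of_real (B $$ (i,j) / s) * z $ j) = \<nu> * z $ i"
      using arg_cong[OF eq, of "\<lambda>v. v $ i"] i zc B by (simp add: mult_mat_vec_sum[of _ n n])
    then have "s * (\<Sum>j<n. of_real (B $$ (i,j) / s) * z $ j) = s * (\<nu> * z $ i)" by (rule arg_cong)
    moreover have "of_real s * (\<Sum>j<n. of_real (B $$ (i,j) / s) * z $ j) = (\<Sum>j<n. of_real (B $$ (i,j)) * z $ j)"
      using s by (simp add: sum_distrib_left)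
    ultimately have "(\<Sum>j<n. of_real (B $$ (i,j)) * z $ j) = s * (\<nu> * z $ i)"
      by metis
    then show "(?B *\<^sub>v z) $ i = ((s * \<nu>) \<cdot>\<^sub>v z) $ i"
      using i zc B by (simp add: mult_mat_vec_sum[of _ n n] mult.assoc)
  qed (use zc B in auto)
  then have "eigenvalue ?B (s * \<nu>)"
    using z B unfolding eigenvalue_def eigenvector_def by auto
  from perron_eigenvalue_ge[OF B n this] s(2) have "s * cmod \<nu> \<le> perron_eigenvalue B"
    by (simp add: norm_mult)
  with s(1) have "s * cmod \<nu> < s * 1" by linarith
  then have "cmod \<nu> < 1" using s(2) by (meson mult_left_less_imp_less less_imp_le)
  then show ?thesis using \<nu> by simp
qed

text \<open>
  For \<open>\<rho> < s < r\<close> the matrix \<open>B / s\<close> has spectral radius below 1, so its powers are bounded,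
  while \<open>B u \<ge> r u\<close> makes them multiply \<open>u\<close> by at least \<open>(r / s)\<^sup>k\<close>.
\<close>

lemma le_perron_eigenvalue_if_expanding:
  assumes B: "B \<in> carrier_mat n n" and nn: "nonneg_mat B"
    and u: "u \<in> carrier_vec n" "\<And>i. i < n \<Longrightarrow> 0 \<le> u $ i" and i: "i < n" "0 < u $ i"
    and grow: "\<And>i. i < n \<Longrightarrow> r * u $ i \<le> (B *\<^sub>v u) $ i"
  shows "r \<le> perron_eigenvalue B"
proof (rule ccontr)
  assume "\<not> r \<le> perron_eigenvalue B"
  then obtain s where s: "perron_eigenvalue B < s" "s < r" using dense by (meson not_le)
  have n: "0 < n" using i by simp
  have "0 \<le> perron_eigenvalue B"
    using perron_eigenvalue_attained[OF B n] by (metis norm_ge_zero)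
  with s have s0: "0 < s" by simp
  define D where "D = (1 / s) \<cdot>\<^sub>m B"
  have D: "D \<in> carrier_mat n n" "nonneg_mat D"
    using B nn s0 by (auto simp: D_def nonneg_mat_def)
  obtain c where c: "\<And>k. norm_bound (map_mat complex_of_real D ^\<^sub>m k) c"
    using spectral_radius_jnf_norm_bound_less_1_upper_triangular[of "map_mat complex_of_real D" n]
      perron_eigenvalue_smult_less_1[OF B n s(1) s0] D
    by (auto simp: D_def perron_eigenvalue_def)
  have bound: "(D ^\<^sub>m k) $$ (a, b) \<le> c" if "a < n" "b < n" for a b k
  proof -
    have "map_mat complex_of_real D ^\<^sub>m k = map_mat complex_of_real (D ^\<^sub>m k)"
      by (rule of_real_hom.mat_hom_pow[OF D(1), symmetric])
    moreover have "D ^\<^sub>m k \<in> carrier_mat n n" using D(1) by simp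
    ultimately have "cmod (complex_of_real ((D ^\<^sub>m k) $$ (a, b))) \<le> c"
      using c[of k, unfolded norm_bound_def, rule_format, of a b] that
      by (metis carrier_matD index_map_mat)
    then show ?thesis by simp
  qed
  have lower: "(r / s) ^ k * u $ a \<le> ((D ^\<^sub>m k) *\<^sub>v u) $ a" if "a < n" for a k
    using that
  proof (induction k arbitrary: a)
    case 0
    then show ?case using D(1) u by simp
  next
    case (Suc k)
    have Dk: "D ^\<^sub>m k \<in> carrier_mat n n" "nonneg_mat (D ^\<^sub>m k)"
      using D nonneg_pow_mat by auto
    have "(r / s) ^ Suc k * u $ a = (r / s) * ((r / s) ^ k * u $ a)" by simp
    also have "\<dots> \<le> (r / s) * ((D ^\<^sub>m k) *\<^sub>v u) $ a"
      using Suc s0 s(2) by (intro mult_left_mono) auto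
    also have "\<dots> = ((D ^\<^sub>m k) *\<^sub>v ((r / s) \<cdot>\<^sub>v u)) $ a"
      using Dk(1) D(1) u(1) Suc.prems by (simp add: mult_mat_vec[of _ n n])
    also have "\<dots> \<le> ((D ^\<^sub>m k) *\<^sub>v (D *\<^sub>v u)) $ a"
    proof (rule nonneg_mult_mat_vec_mono[OF Dk])
      fix j assume j: "j < n"
      have "(D *\<^sub>v u) $ j = (B *\<^sub>v u) $ j / s"
        using B u j by (simp add: D_def mult_mat_vec_sum[of _ n n] sum_divide_distrib)
      then show "((r / s) \<cdot>\<^sub>v u) $ j \<le> (D *\<^sub>v u) $ j"
        using grow[OF j] s0 j u(1) by (simp add: divide_right_mono)
    qed (use D u Suc.prems in auto)
    also have "\<dots> = ((D ^\<^sub>m Suc k) *\<^sub>v u) $ a"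
      using assoc_mult_mat_vec[OF Dk(1) D(1) u(1)] by simp
    finally show ?case .
  qed
  have upper: "((D ^\<^sub>m k) *\<^sub>v u) $ i \<le> c * (\<Sum>j<n. u $ j)" for k
    using bound i u D(1)
    by (auto simp: mult_mat_vec_sum[of _ n n] sum_distrib_left intro!: sum_mono mult_right_mono)
  obtain k where "c * (\<Sum>j<n. u $ j) / u $ i < (r / s) ^ k"
    using real_arch_pow[of "r / s"] s s0 by auto
  then have "c * (\<Sum>j<n. u $ j) < (r / s) ^ k * u $ i"
    using i(2) by (simp add: divide_less_eq)
  with lower[OF i(1), of k] upper[of k] show False by linarith
qed


section \<open>Perron's theorem for primitive matrices\<close>

text \<open>
  Equality in the triangle inequality: after rotating the sum onto the positive real axis, every
  term has real part at most its modulus, and the sum of the differences vanishes.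
\<close>

lemma sum_norm_eq_imp_same_phase:
  fixes w :: "'i \<Rightarrow> complex"
  assumes fin: "finite I" and eq: "cmod (\<Sum>i\<in>I. w i) = (\<Sum>i\<in>I. cmod (w i))"
  obtains c where "\<And>i. i \<in> I \<Longrightarrow> w i = c * of_real (cmod (w i))"
proof (cases "(\<Sum>i\<in>I. w i) = 0")
  case True
  then have "cmod (w i) = 0" if "i \<in> I" for i
    using eq that fin by (simp add: sum_nonneg_eq_0_iff)
  then show ?thesis using that[of 1] by simp
next
  case False
  define S where "S = (\<Sum>i\<in>I. w i)"
  define c where "c = S / of_real (cmod S)"
  have "cmod c = 1" using False by (simp add: c_def S_def norm_divide)
  moreover have "cnj c * c = 1"
    using complex_norm_square[of c] \<open>cmod c = 1\<close> by (simp add: mult.commute)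
  ultimately have c: "cnj c * c = 1" "cmod c = 1" by simp_all
  have "cnj c * S = of_real (cmod S)"
  proof -
    have "S = c * of_real (cmod S)" using False by (simp add: c_def S_def)
    then have "cnj c * S = (cnj c * c) * of_real (cmod S)" by (metis mult.assoc)
    then show ?thesis using c by simp
  qed
  then have "Re (cnj c * S) = cmod S" by simp
  then have "(\<Sum>i\<in>I. Re (cnj c * w i)) = (\<Sum>i\<in>I. cmod (w i))"
    using eq by (simp only: S_def sum_distrib_left Re_sum)
  then have "(\<Sum>i\<in>I. cmod (w i) - Re (cnj c * w i)) = 0" by (simp add: sum_subtractf)
  moreover have le: "Re (cnj c * w i) \<le> cmod (w i)" for i
    using complex_Re_le_cmod[of "cnj c * w i"] c(2) by (simp add: norm_mult)
  ultimately have Re: "Re (cnj c * w i) = cmod (w i)" if "i \<in> I" for i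
    using that fin by (subst (asm) sum_nonneg_eq_0_iff) auto
  have "w i = c * of_real (cmod (w i))" if "i \<in> I" for i
  proof -
    define u where "u = cnj c * w i"
    have Re_u: "Re u = cmod u" "cmod u = cmod (w i)"
      using Re[OF that] c(2) by (simp_all add: u_def norm_mult)
    then have "Im u = 0" using cmod_power2[of u] by simp
    with Re_u have "u = of_real (cmod (w i))" by (simp add: complex_eq_iff)
    then have "cnj c * w i = of_real (cmod (w i))" by (simp only: u_def)
    then have "c * (cnj c * w i) = c * of_real (cmod (w i))" by simp
    moreover have "c * (cnj c * w i) = (cnj c * c) * w i" by simp
    ultimately show ?thesis using c(1) by simp
  qed
  then show ?thesis using that by blast
qed

context
  fixes B :: "real mat" and n :: nat
  assumes B: "B \<in> carrier_mat n n" and n: "0 < n" and prim: "primitive_mat B"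
begin

lemma primitive_nonneg: "nonneg_mat B"
  using prim by (simp add: primitive_mat_def)

text \<open>
  Let \<open>E\<close> be a positive power of \<open>B\<close>, which commutes with \<open>B\<close>. If \<open>B v - \<rho> v\<close> were nonzero,
  then \<open>u = E v\<close> would satisfy \<open>B u > \<rho> u\<close> in every entry, hence \<open>B u \<ge> (\<rho> + \<delta>) u\<close>
  for some \<open>\<delta> > 0\<close>, contradicting that no vector expands faster than the spectral radius.
\<close>

lemma superinvariant_imp_perron_eigen:
  assumes v: "v \<in> carrier_vec n" "\<And>i. i < n \<Longrightarrow> 0 \<le> v $ i" "v \<noteq> 0\<^sub>v n"
    and ge: "\<And>i. i < n \<Longrightarrow> perron_eigenvalue B * v $ i \<le> (B *\<^sub>v v) $ i"
  shows "B *\<^sub>v v = perron_eigenvalue B \<cdot>\<^sub>v v"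
proof (rule ccontr)
  assume neq: "\<not> ?thesis"
  obtain m where m: "positive_mat (B ^\<^sub>m m)" using prim by (auto simp: primitive_mat_def)
  define E where "E = B ^\<^sub>m m"
  have E: "E \<in> carrier_mat n n" "positive_mat E" using B m by (auto simp: E_def)
  define d where "d = B *\<^sub>v v - perron_eigenvalue B \<cdot>\<^sub>v v"
  have d: "d \<in> carrier_vec n" using B v by (simp add: d_def)
  have d_nonneg: "0 \<le> d $ i" if "i < n" for i
    using ge[OF that] B v that by (simp add: d_def)
  have "d \<noteq> 0\<^sub>v n"
  proof
    assume "d = 0\<^sub>v n"
    then have "d $ i = 0" if "i < n" for i
      using that by simp
    then have "(B *\<^sub>v v) $ i - perron_eigenvalue B * v $ i = 0" if "i < n" for i
      using that B v by (simp add: d_def)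
    then have "B *\<^sub>v v = perron_eigenvalue B \<cdot>\<^sub>v v"
      using B v by (intro eq_vecI) auto
    with neq show False by simp
  qed
  then have Ed: "0 < (E *\<^sub>v d) $ i" if "i < n" for i
    using positive_mult_mat_vec[OF E d d_nonneg] that by blast
  define u where "u = E *\<^sub>v v"
  have u: "u \<in> carrier_vec n" "\<And>i. i < n \<Longrightarrow> 0 < u $ i"
    using positive_mult_mat_vec[OF E v] E v by (auto simp: u_def)
  have "E *\<^sub>v (B *\<^sub>v v) = B *\<^sub>v u"
    using mult_pow_mat_commute[OF B, of m] B E v assoc_mult_mat_vec[of B n n E n v]
      assoc_mult_mat_vec[of E n n B n v] by (simp add: u_def E_def)
  then have Bu: "(B *\<^sub>v u) $ i = perron_eigenvalue B * u $ i + (E *\<^sub>v d) $ i" if "i < n" for i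
    using that E B v by (simp add: d_def u_def mult_minus_distrib_mat_vec[of _ n n] mult_mat_vec[of _ n n])
  define \<delta> where "\<delta> = Min ((\<lambda>i. (E *\<^sub>v d) $ i / u $ i) ` {..<n})"
  have "0 < \<delta>"
    unfolding \<delta>_def using n Ed u(2) by (subst Min_gr_iff) auto
  have "(perron_eigenvalue B + \<delta>) * u $ i \<le> (B *\<^sub>v u) $ i" if "i < n" for i
  proof -
    have "\<delta> \<le> (E *\<^sub>v d) $ i / u $ i" unfolding \<delta>_def using that by (intro Min_le) auto
    then show ?thesis using u(2)[OF that] Bu[OF that] by (simp add: field_simps)
  qed
  then have "perron_eigenvalue B + \<delta> \<le> perron_eigenvalue B"
    using le_perron_eigenvalue_if_expanding[OF B primitive_nonneg u(1) _ n] u(2) n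
    by (meson less_imp_le)
  with \<open>0 < \<delta>\<close> show False by simp
qed

text \<open>
  A positive power of \<open>B\<close> maps \<open>v\<close> to the positive vector \<open>r\<^sup>m v\<close>, so no entry of \<open>v\<close> can vanish.
\<close>

lemma nonneg_eigenvector_positive:
  assumes v: "v \<in> carrier_vec n" "\<And>i. i < n \<Longrightarrow> 0 \<le> v $ i" "v \<noteq> 0\<^sub>v n"
    and eig: "B *\<^sub>v v = r \<cdot>\<^sub>v v"
  shows "positive_vec v" "0 < r"
proof -
  obtain m where m: "1 \<le> m" "positive_mat (B ^\<^sub>m m)" using prim by (auto simp: primitive_mat_def)
  have "eigenvector B v r" using v eig B by (auto simp: eigenvector_def)
  then have pow: "B ^\<^sub>m m *\<^sub>v v = r ^ m \<cdot>\<^sub>v v" by (rule eigenvector_pow[OF B])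
  have pos: "0 < r ^ m * v $ i" if "i < n" for i
    using positive_mult_mat_vec[of "B ^\<^sub>m m" n v i] pow m B v that by auto
  have vpos: "0 < v $ i" if "i < n" for i
    using pos[OF that] v(2)[OF that] by (metis less_irrefl mult_zero_right order_less_le)
  then show "positive_vec v" using v(1) by (simp add: positive_vec_def)
  have "0 \<le> (B *\<^sub>v v) $ 0"
    using nonneg_mult_mat_vec_mono[OF B primitive_nonneg, of "0\<^sub>v n" v 0] v n B
    by (simp add: mult_mat_vec_sum[of _ n n])
  then have "0 \<le> r" using eig vpos[OF n] n v(1) by (simp add: zero_le_mult_iff)
  moreover have "r \<noteq> 0" using pos[OF n] m(1) by (auto simp: power_0_left)
  ultimately show "0 < r" by simp
qed

text \<open>
  The triangle inequality gives \<open>B |z| \<ge> |B z| = \<rho> |z|\<close>.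
\<close>

lemma cmod_dominant_eigenvector:
  assumes z: "eigenvector (map_mat complex_of_real B) z \<mu>" and \<mu>: "cmod \<mu> = perron_eigenvalue B"
  shows "perron_eigenvector B (map_vec cmod z)"
proof -
  let ?v = "map_vec cmod z"
  have zc: "z \<in> carrier_vec n" "z \<noteq> 0\<^sub>v n" and eig: "map_mat complex_of_real B *\<^sub>v z = \<mu> \<cdot>\<^sub>v z"
    using z B by (auto simp: eigenvector_def)
  have v: "?v \<in> carrier_vec n" "\<And>i. i < n \<Longrightarrow> 0 \<le> ?v $ i" using zc by auto
  have v0: "?v \<noteq> 0\<^sub>v n"
  proof
    assume "?v = 0\<^sub>v n"
    then have "?v $ i = 0" if "i < n" for i
      using that by (simp del: index_map_vec)
    then have "z $ i = 0" if "i < n" for i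
      using that zc by simp
    then have "z = 0\<^sub>v n" using zc(1) by (intro eq_vecI) auto
    with zc show False by simp
  qed
  have "perron_eigenvalue B * ?v $ i \<le> (B *\<^sub>v ?v) $ i" if i: "i < n" for i
  proof -
    have "perron_eigenvalue B * ?v $ i = cmod (\<mu> * z $ i)" using i zc \<mu> by (simp add: norm_mult)
    also have "\<mu> * z $ i = (\<Sum>j<n. of_real (B $$ (i, j)) * z $ j)"
      using arg_cong[OF eig, of "\<lambda>w. w $ i"] i zc B by (simp add: mult_mat_vec_sum[of _ n n])
    also have "cmod \<dots> \<le> (\<Sum>j<n. cmod (of_real (B $$ (i, j)) * z $ j))" by (rule norm_sum)
    also have "\<dots> = (B *\<^sub>v ?v) $ i"
      using i zc B primitive_nonneg
      by (auto simp: mult_mat_vec_sum[of _ n n] norm_mult nonneg_mat_def intro!: sum.cong)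
    finally show ?thesis .
  qed
  from superinvariant_imp_perron_eigen[OF v v0 this]
  have "B *\<^sub>v ?v = perron_eigenvalue B \<cdot>\<^sub>v ?v" .
  with nonneg_eigenvector_positive(1)[OF v v0 this] v v0 B show ?thesis
    by (auto simp: perron_eigenvector_def eigenvector_def)
qed

lemma perron_eigenvector_exists: "\<exists>x. perron_eigenvector B x"
  using perron_eigenvalue_attained[OF B n] cmod_dominant_eigenvector by metis

lemma perron_eigenvectorD:
  assumes "perron_eigenvector B x"
  shows "x \<in> carrier_vec n" "B *\<^sub>v x = perron_eigenvalue B \<cdot>\<^sub>v x" "\<And>i. i < n \<Longrightarrow> 0 < x $ i"
    "x \<noteq> 0\<^sub>v n"
  using assms B by (auto simp: perron_eigenvector_def eigenvector_def positive_vec_def)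

lemma perron_eigenvalue_pos: "0 < perron_eigenvalue B"
proof -
  obtain x where "perron_eigenvector B x" using perron_eigenvector_exists by blast
  from perron_eigenvectorD[OF this] nonneg_eigenvector_positive(2)[of x] show ?thesis
    by (meson less_imp_le)
qed

text \<open>
  With \<open>t\<close> the least ratio \<open>w\<^sub>i / x\<^sub>i\<close>, the vector \<open>w - t x\<close> is nonnegative with a zero entry, so it
  cannot be a (necessarily positive) eigenvector and must vanish.
\<close>

lemma perron_eigenspace_real:
  assumes x: "perron_eigenvector B x"
    and w: "w \<in> carrier_vec n" "B *\<^sub>v w = perron_eigenvalue B \<cdot>\<^sub>v w"
  shows "\<exists>c. w = c \<cdot>\<^sub>v x"
proof -
  note x = perron_eigenvectorD[OF x]
  define t where "t = Min ((\<lambda>i. w $ i / x $ i) ` {..<n})"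
  have "t \<in> (\<lambda>i. w $ i / x $ i) ` {..<n}" unfolding t_def using n by (intro Min_in) auto
  then obtain k where k: "k < n" "t = w $ k / x $ k" by auto
  define v where "v = w - t \<cdot>\<^sub>v x"
  have v: "v \<in> carrier_vec n" using w x by (simp add: v_def)
  have v_nonneg: "0 \<le> v $ i" if "i < n" for i
  proof -
    have "t \<le> w $ i / x $ i" unfolding t_def using that by (intro Min_le) auto
    then show ?thesis using x(3)[OF that] that w x(1) by (simp add: v_def field_simps)
  qed
  have "v $ k = 0" using k w x(1) x(3)[OF k(1)] by (simp add: v_def)
  have eig: "B *\<^sub>v v = perron_eigenvalue B \<cdot>\<^sub>v v"
    using w x B by (auto simp: v_def mult_minus_distrib_mat_vec[of _ n n] mult_mat_vec[of _ n n] algebra_simps intro!: eq_vecI)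
  have "v = 0\<^sub>v n"
  proof (rule ccontr)
    assume "v \<noteq> 0\<^sub>v n"
    from nonneg_eigenvector_positive(1)[OF v v_nonneg this eig] k(1) v \<open>v $ k = 0\<close>
    show False by (auto simp: positive_vec_def)
  qed
  then have "v $ i = 0" if "i < n" for i
    using that by simp
  then have "w $ i - t * x $ i = 0" if "i < n" for i
    using that w x(1) by (simp add: v_def)
  then have "w = t \<cdot>\<^sub>v x" using w x(1) by (intro eq_vecI) auto
  then show ?thesis ..
qed

lemma perron_eigenspace_complex:
  assumes x: "perron_eigenvector B x"
    and z: "z \<in> carrier_vec n" "map_mat complex_of_real B *\<^sub>v z = of_real (perron_eigenvalue B) \<cdot>\<^sub>v z"
  shows "\<exists>c. z = c \<cdot>\<^sub>v map_vec complex_of_real x"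
proof -
  have *: "(\<Sum>j<n. of_real (B $$ (i,j)) * z $ j) = of_real (perron_eigenvalue B) * z $ i" if "i < n" for i
    using arg_cong[OF z(2), of "\<lambda>w. w $ i"] that z(1) B by (simp add: mult_mat_vec_sum[of _ n n])
  have "B *\<^sub>v map_vec Re z = perron_eigenvalue B \<cdot>\<^sub>v map_vec Re z"
    using z(1) B arg_cong[OF *, of _ Re] by (intro eq_vecI) (auto simp: mult_mat_vec_sum[of _ n n])
  then obtain a where a: "map_vec Re z = a \<cdot>\<^sub>v x"
    using perron_eigenspace_real[OF x, of "map_vec Re z"] z(1) by auto
  have "B *\<^sub>v map_vec Im z = perron_eigenvalue B \<cdot>\<^sub>v map_vec Im z"
    using z(1) B arg_cong[OF *, of _ Im] by (intro eq_vecI) (auto simp: mult_mat_vec_sum[of _ n n])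
  then obtain b where b: "map_vec Im z = b \<cdot>\<^sub>v x"
    using perron_eigenspace_real[OF x, of "map_vec Im z"] z(1) by auto
  have xc: "x \<in> carrier_vec n" by (rule perron_eigenvectorD[OF x])
  have "z $ i = Complex a b * of_real (x $ i)" if "i < n" for i
    using that z(1) xc arg_cong[OF a, of "\<lambda>w. w $ i"] arg_cong[OF b, of "\<lambda>w. w $ i"]
    by (simp add: complex_eq_iff)
  then have "z = Complex a b \<cdot>\<^sub>v map_vec complex_of_real x"
    using z(1) xc by (intro eq_vecI) auto
  then show ?thesis ..
qed

text \<open>
  If \<open>|\<mu>| = \<rho>\<close>, then \<open>v = |z|\<close> is a Perron vector, and for a positive power \<open>E\<close> of \<open>B\<close> the first entry
  of \<open>E z\<close> attains equality in the triangle inequality. As all weights of \<open>E\<close> are positive, all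
  entries of \<open>z\<close> have the same phase; so \<open>z\<close> is a multiple of \<open>v\<close> and \<open>\<mu> = \<rho>\<close>.
\<close>

lemma perron_eigenvalue_dominant:
  assumes ev: "eigenvalue (map_mat complex_of_real B) \<mu>"
  shows "\<mu> = of_real (perron_eigenvalue B) \<or> cmod \<mu> < perron_eigenvalue B"
proof (cases "cmod \<mu> = perron_eigenvalue B")
  case False
  then show ?thesis using perron_eigenvalue_ge[OF B n ev] by simp
next
  case True
  let ?B = "map_mat complex_of_real B" and ?\<rho> = "perron_eigenvalue B"
  obtain z where z: "eigenvector ?B z \<mu>" using ev by (auto simp: eigenvalue_def)
  define v where "v = map_vec cmod z"
  have v: "perron_eigenvector B v" unfolding v_def by (rule cmod_dominant_eigenvector[OF z True])
  note v = v perron_eigenvectorD[OF v]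
  have zc: "z \<in> carrier_vec n" "?B *\<^sub>v z = \<mu> \<cdot>\<^sub>v z" using z B by (auto simp: eigenvector_def)
  obtain m where m: "positive_mat (B ^\<^sub>m m)" using prim by (auto simp: primitive_mat_def)
  define E where "E = B ^\<^sub>m m"
  have E: "E \<in> carrier_mat n n" "\<And>i j. i < n \<Longrightarrow> j < n \<Longrightarrow> 0 < E $$ (i,j)"
    using B m by (auto simp: E_def positive_mat_def)
  have "map_mat complex_of_real E *\<^sub>v z = \<mu> ^ m \<cdot>\<^sub>v z"
    using eigenvector_pow[of ?B n z \<mu> m] z B of_real_hom.mat_hom_pow[OF B, of m, where ?'a = complex]
    by (simp add: E_def)
  from arg_cong[OF this, of "\<lambda>w. w $ 0"]
  have Ez: "(\<Sum>j<n. of_real (E $$ (0, j)) * z $ j) = \<mu> ^ m * z $ 0"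
    using n zc E by (simp add: mult_mat_vec_sum[of _ n n])
  have "E *\<^sub>v v = ?\<rho> ^ m \<cdot>\<^sub>v v"
    using eigenvector_pow[OF B, of v ?\<rho> m] v(1) by (simp add: E_def perron_eigenvector_def)
  from arg_cong[OF this, of "\<lambda>w. w $ 0"]
  have Ev: "(\<Sum>j<n. E $$ (0, j) * v $ j) = ?\<rho> ^ m * v $ 0"
    using n v(2) E by (simp add: mult_mat_vec_sum[of _ n n])
  have norms: "cmod (of_real (E $$ (0, j)) * z $ j) = E $$ (0, j) * v $ j" if "j < n" for j
    using E(2)[OF n that] zc that by (simp add: norm_mult v_def)
  have "cmod (\<Sum>j<n. of_real (E $$ (0, j)) * z $ j) = (\<Sum>j<n. cmod (of_real (E $$ (0, j)) * z $ j))"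
  proof -
    have "(\<Sum>j<n. cmod (of_real (E $$ (0, j)) * z $ j)) = (\<Sum>j<n. E $$ (0, j) * v $ j)"
      using norms by (intro sum.cong) auto
    also have "\<dots> = cmod (\<mu> ^ m * z $ 0)"
      unfolding Ev using True n zc by (simp add: norm_mult norm_power v_def)
    finally show ?thesis by (simp only: Ez)
  qed
  then obtain c where c: "\<And>j. j < n \<Longrightarrow>
      of_real (E $$ (0, j)) * z $ j = c * of_real (cmod (of_real (E $$ (0, j)) * z $ j))"
    using sum_norm_eq_imp_same_phase[OF finite_lessThan] by auto
  have zj: "z $ j = c * of_real (v $ j)" if "j < n" for j
    using c[OF that] E(2)[OF n that] unfolding norms[OF that] by simp
  have "\<mu> * z $ 0 = (\<Sum>j<n. of_real (B $$ (0, j)) * z $ j)"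
    using arg_cong[OF zc(2), of "\<lambda>w. w $ 0"] n zc(1) B by (simp add: mult_mat_vec_sum[of _ n n])
  also have "\<dots> = c * of_real (\<Sum>j<n. B $$ (0, j) * v $ j)"
    using zj by (simp add: sum_distrib_left mult_ac)
  also have "(\<Sum>j<n. B $$ (0, j) * v $ j) = ?\<rho> * v $ 0"
    using arg_cong[OF v(3), of "\<lambda>w. w $ 0"] n v(2) B by (simp add: mult_mat_vec_sum[of _ n n])
  also have "c * of_real (?\<rho> * v $ 0) = of_real ?\<rho> * z $ 0" using zj[OF n] by simp
  finally have "\<mu> * z $ 0 = of_real ?\<rho> * z $ 0" .
  moreover have "z $ 0 \<noteq> 0" using v(4)[OF n] n zc by (auto simp: v_def)
  ultimately show ?thesis by simp
qed

end

section \<open>Left Perron vectors, simplicity and solvability\<close>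

lemma primitive_transpose:
  assumes "B \<in> carrier_mat n n" "primitive_mat B"
  shows "primitive_mat (transpose_mat B)"
proof -
  obtain m where m: "1 \<le> m" "positive_mat (B ^\<^sub>m m)"
    using assms(2) by (auto simp: primitive_mat_def)
  have "B ^\<^sub>m m \<in> carrier_mat n n" using assms(1) by simp
  then have "positive_mat (transpose_mat (B ^\<^sub>m m))"
    using m(2) by (auto simp: positive_mat_def simp del: pow_mat_dim)
  then have "positive_mat (transpose_mat B ^\<^sub>m m)"
    by (simp only: transpose_pow_mat[OF assms(1)])
  moreover have "nonneg_mat (transpose_mat B)"
    using assms by (auto simp: primitive_mat_def nonneg_mat_def)
  moreover have "square_mat (transpose_mat B)" using assms(1) by simp
  ultimately show ?thesis using m(1) by (auto simp: primitive_mat_def)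
qed

lemma perron_eigenvalue_transpose:
  assumes B: "B \<in> carrier_mat n n"
  shows "perron_eigenvalue (transpose_mat B) = perron_eigenvalue B"
proof -
  let ?B = "map_mat complex_of_real B"
  have "char_poly (transpose_mat ?B) = char_poly ?B"
    using B by (intro char_poly_transpose_mat[of _ n]) simp
  then have "spectrum (transpose_mat ?B) = spectrum ?B"
    using spectrum_root_char_poly[of ?B n] spectrum_root_char_poly[of "transpose_mat ?B" n] B by simp
  then show ?thesis by (simp add: perron_eigenvalue_def spectral_radius_def map_mat_transpose)
qed

text \<open>
  Formulated for a homomorphism \<open>h\<close> to serve both the real matrix and its complexification.
\<close>

lemma scalar_prod_left_perron:
  fixes h :: "real \<Rightarrow> 'a :: field"
  assumes h: "semiring_hom h" and B: "B \<in> carrier_mat n n"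
    and y: "perron_eigenvector (transpose_mat B) y" and z: "z \<in> carrier_vec n"
  shows "map_vec h y \<bullet> (map_mat h B *\<^sub>v z) = h (perron_eigenvalue B) * (map_vec h y \<bullet> z)"
proof -
  interpret semiring_hom h by (rule h)
  have yc: "y \<in> carrier_vec n" and eig: "transpose_mat B *\<^sub>v y = perron_eigenvalue B \<cdot>\<^sub>v y"
    using y B perron_eigenvalue_transpose[OF B]
    by (auto simp: perron_eigenvector_def eigenvector_def)
  have "transpose_mat (map_mat h B) *\<^sub>v map_vec h y = map_vec h (transpose_mat B *\<^sub>v y)"
    using B yc mult_mat_vec_hom[of "transpose_mat B" n n y] by (simp add: map_mat_transpose)
  also have "\<dots> = h (perron_eigenvalue B) \<cdot>\<^sub>v map_vec h y"
    unfolding eig by (simp add: vec_hom_smult)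
  finally show ?thesis
    using scalar_prod_mult_transpose[of "map_mat h B" n z "map_vec h y"] B yc z by simp
qed

lemma scalar_prod_of_real:
  assumes "dim_vec u = dim_vec v"
  shows "map_vec complex_of_real u \<bullet> map_vec complex_of_real v = of_real (u \<bullet> v)"
  using assms by (simp add: scalar_prod_def)

text \<open>
  Schur triangularisation with the double root placed in the first two diagonal positions; the
  first two columns of the transformation form an eigenvector and a generalised eigenvector.
\<close>

lemma double_root_triangularisation:
  fixes C :: "complex mat"
  assumes C: "C \<in> carrier_mat n n" and dvd: "[:- e, 1:] ^ 2 dvd char_poly C"
  obtains P Q t where "P \<in> carrier_mat n n" "Q \<in> carrier_mat n n" "Q * P = 1\<^sub>m n" "1 < n"
    "C *\<^sub>v col P 0 = e \<cdot>\<^sub>v col P 0" "C *\<^sub>v col P 1 = t \<cdot>\<^sub>v col P 0 + e \<cdot>\<^sub>v col P 1"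
proof -
  obtain q where q: "char_poly C = [:- e, 1:] ^ 2 * q" using dvd by (auto simp: dvd_def)
  have "lead_coeff (char_poly C) = 1" using degree_monic_char_poly[OF C] by simp
  then have "lead_coeff q = 1" unfolding q by (simp add: lead_coeff_mult lead_coeff_power)
  moreover obtain as where "Polynomial.smult (lead_coeff q) (\<Prod>a\<leftarrow>as. [:- a, 1:]) = q"
    using fundamental_theorem_algebra_factorized[of q] by auto
  ultimately have "char_poly C = (\<Prod>a\<leftarrow>e # e # as. [:- a, 1:])"
    unfolding q by (simp only: power2_eq_square mult.assoc list.map prod_list.Cons smult_1_left)
  moreover obtain T P Q where "schur_decomposition C (e # e # as) = (T, P, Q)"
    by (rule prod_cases3)
  ultimately have schur: "similar_mat_wit C T P Q" "upper_triangular T" "diag_mat T = e # e # as"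
    using schur_decomposition[of C n "e # e # as" T P Q] C by blast+
  note sim = similar_mat_witD2[OF C schur(1)]
  have n: "1 < n" using arg_cong[OF schur(3), of length] sim(5) by (simp add: diag_mat_def)
  have T: "T $$ (0, 0) = e" "T $$ (1, 1) = e"
    using arg_cong[OF schur(3), of "\<lambda>l. l ! 0"] arg_cong[OF schur(3), of "\<lambda>l. l ! 1"] sim(5) n
    by (simp_all add: diag_mat_def)
  have lower: "T $$ (i, j) = 0" if "j < i" "i < n" for i j
    using schur(2) sim(5) that by (simp add: upper_triangular_def)
  have "C * P = P * T * (Q * P)"
    unfolding sim(3) using sim(4-7) by (simp add: assoc_mult_mat[of _ n n _ n _ n])
  then have CP: "C * P = P * T" using sim by simp
  have col: "(C *\<^sub>v col P j) $ i = (\<Sum>k<n. P $$ (i, k) * T $$ (k, j))" if "i < n" "j < n" for i j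
  proof -
    have "(C *\<^sub>v col P j) $ i = (C * P) $$ (i, j)"
      using that C sim(6) by (simp add: index_mult_mat_vec)
    also have "\<dots> = (P * T) $$ (i, j)" by (simp only: CP)
    finally show ?thesis
      using that sim(5,6) by (simp add: scalar_prod_def atLeast0LessThan)
  qed
  have sum0: "(\<Sum>k<n. P $$ (i, k) * T $$ (k, 0)) = (\<Sum>k\<in>{0}. P $$ (i, k) * T $$ (k, 0))" for i
    using n lower by (intro sum.mono_neutral_right) auto
  have sum1: "(\<Sum>k<n. P $$ (i, k) * T $$ (k, 1)) = (\<Sum>k\<in>{0,1}. P $$ (i, k) * T $$ (k, 1))" for i
    using n lower by (intro sum.mono_neutral_right) auto
  have c0: "C *\<^sub>v col P 0 = e \<cdot>\<^sub>v col P 0"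
    using n C sim(6) T sum0 col by (intro eq_vecI) auto
  have c1: "C *\<^sub>v col P 1 = T $$ (0, 1) \<cdot>\<^sub>v col P 0 + e \<cdot>\<^sub>v col P 1"
    using n C sim(6) T sum1 col by (intro eq_vecI) auto
  show ?thesis by (rule that[OF sim(6,7,2) n c0 c1])
qed

context
  fixes B :: "real mat" and n :: nat and x y :: "real vec"
  assumes B: "B \<in> carrier_mat n n" and n: "0 < n" and prim: "primitive_mat B"
    and x: "perron_eigenvector B x" and y: "perron_eigenvector (transpose_mat B) y"
begin

lemma perron_vec_carrier: "x \<in> carrier_vec n" "y \<in> carrier_vec n"
  using x y B by (auto simp: perron_eigenvector_def eigenvector_def)

lemma left_right_perron_pos: "0 < y \<bullet> x"
  using x y perron_vec_carrier perron_eigenvectorD[OF B n prim x]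
  by (intro scalar_prod_positive[of y n x]) (auto simp: perron_eigenvector_def less_imp_le)

lemma scalar_prod_left_perron_real:
  assumes "z \<in> carrier_vec n"
  shows "y \<bullet> (B *\<^sub>v z) = perron_eigenvalue B * (y \<bullet> z)"
proof -
  have "map_vec (\<lambda>a. a) y = y" "map_mat (\<lambda>a. a) B = B" by (auto intro!: eq_vecI eq_matI)
  moreover have "semiring_hom (\<lambda>a :: real. a)" by unfold_locales auto
  ultimately show ?thesis
    using scalar_prod_left_perron[of "\<lambda>a. a" B n y z] B y assms by simp
qed

lemma scalar_prod_left_perron_complex:
  assumes "z \<in> carrier_vec n"
  shows "map_vec complex_of_real y \<bullet> (map_mat complex_of_real B *\<^sub>v z) =
    of_real (perron_eigenvalue B) * (map_vec complex_of_real y \<bullet> z)"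
  using scalar_prod_left_perron[of complex_of_real B n y z] B y assms
    of_real_hom.semiring_hom_axioms by simp

text \<open>
  A double root would give independent vectors \<open>p\<^sub>0, p\<^sub>1\<close> with \<open>B p\<^sub>0 = \<rho> p\<^sub>0\<close> and
  \<open>B p\<^sub>1 = t p\<^sub>0 + \<rho> p\<^sub>1\<close>. Here \<open>p\<^sub>0\<close> is a nonzero multiple of \<open>x\<close>, so multiplying by \<open>y\<close> yields
  \<open>t = 0\<close>. Then \<open>p\<^sub>1\<close> is an eigenvector too, and both lie on the line spanned by \<open>x\<close>.
\<close>

lemma perron_eigenvalue_simple: "order (perron_eigenvalue B) (char_poly B) = 1"
proof -
  let ?\<rho> = "perron_eigenvalue B" and ?C = "map_mat complex_of_real B"
  let ?x = "map_vec complex_of_real x" and ?y = "map_vec complex_of_real y"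
  note xy = perron_vec_carrier
  have nz: "char_poly B \<noteq> 0" using degree_monic_char_poly[OF B] by auto
  have "eigenvalue B ?\<rho>" using x by (auto simp: perron_eigenvector_def eigenvalue_def)
  then have "order ?\<rho> (char_poly B) \<noteq> 0"
    using nz by (simp add: eigenvalue_root_char_poly[OF B] order_root)
  moreover have "\<not> 2 \<le> order ?\<rho> (char_poly B)"
  proof
    assume "2 \<le> order ?\<rho> (char_poly B)"
    then have "[:- ?\<rho>, 1:] ^ 2 dvd char_poly B" by (metis order_1 power_le_dvd)
    then obtain q where q: "char_poly B = [:- ?\<rho>, 1:] ^ 2 * q" by (auto simp: dvd_def)
    interpret map_poly_comm_ring_hom complex_of_real ..
    have "char_poly ?C = [:- of_real ?\<rho>, 1:] ^ 2 * map_poly of_real q"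
      by (simp add: of_real_hom.char_poly_hom[OF B] q hom_mult hom_power)
    then have "[:- complex_of_real ?\<rho>, 1:] ^ 2 dvd char_poly ?C" by simp
    then obtain P Q t where PQ: "P \<in> carrier_mat n n" "Q \<in> carrier_mat n n" "Q * P = 1\<^sub>m n" "1 < n"
      and c0: "?C *\<^sub>v col P 0 = of_real ?\<rho> \<cdot>\<^sub>v col P 0"
      and c1: "?C *\<^sub>v col P 1 = t \<cdot>\<^sub>v col P 0 + of_real ?\<rho> \<cdot>\<^sub>v col P 1"
      using double_root_triangularisation[of ?C n] B by (metis map_carrier_mat)
    have cols: "col P 0 \<in> carrier_vec n" "col P 1 \<in> carrier_vec n" using PQ by auto
    have QP: "row Q i \<bullet> col P j = (if i = j then 1 else 0)" if "i < n" "j < n" for i j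
      using arg_cong[OF PQ(3), of "\<lambda>M. M $$ (i, j)"] PQ(1,2) that by auto
    obtain a where a: "col P 0 = a \<cdot>\<^sub>v ?x"
      using perron_eigenspace_complex[OF B n prim x cols(1) c0] by blast
    have a0: "a * (row Q 0 \<bullet> ?x) = 1"
      using QP[of 0 0] PQ xy unfolding a by simp
    have yx: "?y \<bullet> ?x \<noteq> 0"
      using scalar_prod_of_real[of y x] xy left_right_perron_pos by simp
    have "?y \<bullet> (?C *\<^sub>v col P 1) = t * (a * (?y \<bullet> ?x)) + of_real ?\<rho> * (?y \<bullet> col P 1)"
      unfolding c1 using cols xy by (simp add: scalar_prod_add_distrib[of _ n] a)
    then have "t * (a * (?y \<bullet> ?x)) = 0"
      using scalar_prod_left_perron_complex[OF cols(2)] by simp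
    then have "t = 0" using yx a0 by auto
    then have "?C *\<^sub>v col P 1 = of_real ?\<rho> \<cdot>\<^sub>v col P 1"
      unfolding c1 using cols by (intro eq_vecI) auto
    then obtain b where b: "col P 1 = b \<cdot>\<^sub>v ?x"
      using perron_eigenspace_complex[OF B n prim x cols(2)] by blast
    have "b * (row Q 0 \<bullet> ?x) = 0" "b * (row Q 1 \<bullet> ?x) = 1"
      using QP[of 0 1] QP[of 1 1] PQ xy unfolding b by simp_all
    with a0 show False by auto
  qed
  ultimately show ?thesis by linarith
qed

text \<open>
  The rank-one perturbation \<open>M = B - \<rho> I + x y\<^sup>T\<close> is invertible, and \<open>y \<bullet> M w = (y \<bullet> w) (y \<bullet> x)\<close>.
  Hence the solution of \<open>M w = b\<close> with \<open>y \<bullet> b = 0\<close> satisfies \<open>y \<bullet> w = 0\<close>, where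
  \<open>M\<close> and \<open>B - \<rho> I\<close> agree.
\<close>

lemma perron_fredholm:
  assumes b: "b \<in> carrier_vec n" "y \<bullet> b = 0"
  shows "\<exists>w \<in> carrier_vec n. B *\<^sub>v w - perron_eigenvalue B \<cdot>\<^sub>v w = b"
proof -
  let ?\<rho> = "perron_eigenvalue B"
  note xy = perron_vec_carrier
  define M where "M = mat n n (\<lambda>(i, j). B $$ (i, j) - (if i = j then ?\<rho> else 0) + x $ i * y $ j)"
  have M: "M \<in> carrier_mat n n" by (simp add: M_def)
  have Mw: "M *\<^sub>v w = (B *\<^sub>v w - ?\<rho> \<cdot>\<^sub>v w) + (y \<bullet> w) \<cdot>\<^sub>v x" if w: "w \<in> carrier_vec n" for w
  proof (rule eq_vecI)
    fix i assume "i < dim_vec (B *\<^sub>v w - ?\<rho> \<cdot>\<^sub>v w + (y \<bullet> w) \<cdot>\<^sub>v x)"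
    then have i: "i < n" using xy by simp
    have "(M *\<^sub>v w) $ i = (\<Sum>j<n. B $$ (i, j) * w $ j - (if i = j then ?\<rho> * w $ j else 0) + x $ i * (y $ j * w $ j))"
      unfolding mult_mat_vec_sum[OF M w i]
      by (rule sum.cong) (use i in \<open>auto simp: M_def left_diff_distrib distrib_right\<close>)
    also have "\<dots> = (\<Sum>j<n. B $$ (i, j) * w $ j) - ?\<rho> * w $ i + x $ i * (y \<bullet> w)"
      using i w by (simp add: sum.distrib sum_subtractf scalar_prod_sum[of _ n] sum_distrib_left)
    finally show "(M *\<^sub>v w) $ i = (B *\<^sub>v w - ?\<rho> \<cdot>\<^sub>v w + (y \<bullet> w) \<cdot>\<^sub>v x) $ i"
      using i w B xy by (simp add: mult_mat_vec_sum[of _ n n])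
  qed (use M xy in auto)
  have yM: "y \<bullet> (M *\<^sub>v w) = (y \<bullet> w) * (y \<bullet> x)" if w: "w \<in> carrier_vec n" for w
    using w xy B scalar_prod_left_perron_real[OF w]
    by (simp add: Mw scalar_prod_add_distrib[of _ n] scalar_prod_minus_distrib[of _ n])
  have yw: "y \<bullet> w = 0" if "w \<in> carrier_vec n" "y \<bullet> (M *\<^sub>v w) = 0" for w
    using yM[OF that(1)] that(2) left_right_perron_pos by simp
  have "det M \<noteq> 0"
  proof
    assume "det M = 0"
    then obtain w where w: "w \<in> carrier_vec n" "w \<noteq> 0\<^sub>v n" "M *\<^sub>v w = 0\<^sub>v n"
      using det_0_iff_vec_prod_zero_field[OF M] by blast
    then have "y \<bullet> w = 0" using yw xy by simp
    then have "B *\<^sub>v w - ?\<rho> \<cdot>\<^sub>v w = 0\<^sub>v n"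
      using Mw[OF w(1)] w xy B by (auto simp: vec_eq_iff)
    then have "B *\<^sub>v w = ?\<rho> \<cdot>\<^sub>v w" using w B by (auto simp: vec_eq_iff)
    then obtain c where "w = c \<cdot>\<^sub>v x" using perron_eigenspace_real[OF B n prim x w(1)] by blast
    with \<open>y \<bullet> w = 0\<close> xy left_right_perron_pos have "w = 0\<^sub>v n" by auto
    with w show False by simp
  qed
  define w where "w = (1 / det M) \<cdot>\<^sub>v (adj_mat M *\<^sub>v b)"
  have w: "w \<in> carrier_vec n" using adj_mat(1)[OF M] b by (simp add: w_def)
  have "M *\<^sub>v w = (1 / det M) \<cdot>\<^sub>v ((M * adj_mat M) *\<^sub>v b)"
    using adj_mat(1)[OF M] M b by (simp add: w_def mult_mat_vec[of _ n n])
  also have "(M * adj_mat M) *\<^sub>v b = det M \<cdot>\<^sub>v b"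
    unfolding adj_mat(2)[OF M] using b(1)
    by (intro eq_vecI) (auto simp: index_mult_mat_vec)
  also have "(1 / det M) \<cdot>\<^sub>v \<dots> = b"
    using \<open>det M \<noteq> 0\<close> by (simp add: smult_smult_assoc)
  finally have Mwb: "M *\<^sub>v w = b" .
  then have "y \<bullet> w = 0" using yw[OF w] b by simp
  then have "B *\<^sub>v w - ?\<rho> \<cdot>\<^sub>v w = b"
    using Mw[OF w] Mwb w xy B by (auto simp: vec_eq_iff)
  with w show ?thesis by blast
qed

text \<open>
  Taking the scalar product with \<open>y\<close> cancels the terms with \<open>w\<close>. In the application \<open>w\<close> is the dual
  part of an eigenvector with standard part \<open>x\<close>, and \<open>b = D x\<close> for the dual part \<open>D\<close> of the matrix.
\<close>

lemma dual_part_of_perron_eigenvector: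
  assumes "w \<in> carrier_vec n" "b \<in> carrier_vec n"
    and eq: "B *\<^sub>v w + b = perron_eigenvalue B \<cdot>\<^sub>v w + d \<cdot>\<^sub>v x"
  shows "y \<bullet> b = d * (y \<bullet> x)"
proof -
  note xy = perron_vec_carrier
  have "y \<bullet> (B *\<^sub>v w) + y \<bullet> b = perron_eigenvalue B * (y \<bullet> w) + d * (y \<bullet> x)"
    using arg_cong[OF eq, of "\<lambda>v. y \<bullet> v"] assms(1,2) xy B
    by (simp add: scalar_prod_add_distrib[of _ n])
  then show ?thesis using scalar_prod_left_perron_real[OF assms(1)] by simp
qed

text \<open>
  The same cancellation for a complex eigenvector with standard part \<open>c x\<close>.
\<close>

lemma dual_part_of_complex_perron_eigenvector:
  assumes "w \<in> carrier_vec n" "b \<in> carrier_vec n"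
    and eq: "map_mat complex_of_real B *\<^sub>v w + c \<cdot>\<^sub>v map_vec complex_of_real b =
      of_real (perron_eigenvalue B) \<cdot>\<^sub>v w + d \<cdot>\<^sub>v (c \<cdot>\<^sub>v map_vec complex_of_real x)"
    and c: "c \<noteq> 0"
  shows "of_real (y \<bullet> b) = d * of_real (y \<bullet> x)"
proof -
  let ?y = "map_vec complex_of_real y"
  note xy = perron_vec_carrier
  have "?y \<bullet> (map_mat complex_of_real B *\<^sub>v w) + c * of_real (y \<bullet> b) =
      of_real (perron_eigenvalue B) * (?y \<bullet> w) + d * (c * of_real (y \<bullet> x))"
    using arg_cong[OF eq, of "\<lambda>v. ?y \<bullet> v"] assms(1,2) xy B
    by (simp add: scalar_prod_add_distrib[of _ n] scalar_prod_of_real)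
  then have "c * of_real (y \<bullet> b) = c * (d * of_real (y \<bullet> x))"
    using scalar_prod_left_perron_complex[OF assms(1)] by simp
  then show ?thesis using c by (metis mult_cancel_left)
qed

text \<open>
  The difference of two solutions is an eigenvector for \<open>\<rho>\<close> or zero, hence a multiple of \<open>x\<close>, and it is orthogonal to \<open>x\<close>.
\<close>

lemma perron_equation_unique_orthogonal:
  assumes w: "w \<in> carrier_vec n" "B *\<^sub>v w + b = perron_eigenvalue B \<cdot>\<^sub>v w + b'" "x \<bullet> w = 0"
    and w': "w' \<in> carrier_vec n" "B *\<^sub>v w' + b = perron_eigenvalue B \<cdot>\<^sub>v w' + b'" "x \<bullet> w' = 0"
    and b: "b \<in> carrier_vec n" "b' \<in> carrier_vec n"
  shows "w = w'"
proof -
  note xc = perron_vec_carrier(1)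
  have "(B *\<^sub>v w) $ i - (B *\<^sub>v w') $ i = perron_eigenvalue B * w $ i - perron_eigenvalue B * w' $ i"
    if "i < n" for i
    using arg_cong[OF w(2), of "\<lambda>v. v $ i"] arg_cong[OF w'(2), of "\<lambda>v. v $ i"] that w(1) w'(1) B b
    by simp
  then have "B *\<^sub>v (w - w') = perron_eigenvalue B \<cdot>\<^sub>v (w - w')"
    using w(1) w'(1) B
    by (intro eq_vecI) (auto simp: mult_minus_distrib_mat_vec[of _ n n] right_diff_distrib)
  then obtain c where c: "w - w' = c \<cdot>\<^sub>v x"
    using perron_eigenspace_real[OF B n prim x, of "w - w'"] w(1) w'(1) by auto
  have "x \<bullet> (w - w') = 0"
    using w w' xc by (simp add: scalar_prod_minus_distrib[of _ n])
  then have "c * (x \<bullet> x) = 0" unfolding c using xc by simp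
  moreover have "0 < x \<bullet> x"
    using perron_eigenvectorD[OF B n prim x] x
    by (intro scalar_prod_positive[of x n x]) (auto simp: perron_eigenvector_def less_imp_le)
  ultimately have "c = 0" by simp
  then have "(w - w') $ i = 0" if "i < n" for i using that xc unfolding c by simp
  then show ?thesis using w(1) w'(1) by (intro eq_vecI) auto
qed

end

section \<open>Dual eigenvectors by their standard and dual parts\<close>

lemma dual_eq_iff: "a = b \<longleftrightarrow> std_part a = std_part b \<and> dual_part a = dual_part b"
  by (auto intro: dual_num.expand)

lemma std_part_sum: "std_part (sum f I) = (\<Sum>i\<in>I. std_part (f i))"
  by (induction I rule: infinite_finite_induct) (auto simp: zero_dual_num_def plus_dual_num_def)

lemma dual_part_sum: "dual_part (sum f I) = (\<Sum>i\<in>I. dual_part (f i))"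
  by (induction I rule: infinite_finite_induct) (auto simp: zero_dual_num_def plus_dual_num_def)

lemma dual_mult_mat_vec_eq_smult_iff:
  fixes A :: "'a :: comm_ring_1 dual_num mat"
  assumes A: "A \<in> carrier_mat n n" and x: "x \<in> carrier_vec n"
  shows "A *\<^sub>v x = \<mu> \<cdot>\<^sub>v x \<longleftrightarrow>
    std_mat A *\<^sub>v std_vec x = std_part \<mu> \<cdot>\<^sub>v std_vec x \<and>
    std_mat A *\<^sub>v dual_vec x + dual_mat A *\<^sub>v std_vec x =
      std_part \<mu> \<cdot>\<^sub>v dual_vec x + dual_part \<mu> \<cdot>\<^sub>v std_vec x"
proof -
  have "A *\<^sub>v x = \<mu> \<cdot>\<^sub>v x \<longleftrightarrow> (\<forall>i<n. (\<Sum>j<n. A $$ (i, j) * x $ j) = \<mu> * x $ i)"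
    using A x by (auto simp: vec_eq_iff mult_mat_vec_sum[of _ n n])
  also have "\<dots> \<longleftrightarrow> (\<forall>i<n.
      (\<Sum>j<n. std_part (A $$ (i, j)) * std_part (x $ j)) = std_part \<mu> * std_part (x $ i) \<and>
      (\<Sum>j<n. std_part (A $$ (i, j)) * dual_part (x $ j) + dual_part (A $$ (i, j)) * std_part (x $ j)) =
      std_part \<mu> * dual_part (x $ i) + dual_part \<mu> * std_part (x $ i))"
    unfolding dual_eq_iff std_part_sum dual_part_sum by (simp add: times_dual_num_def)
  also have "\<dots> \<longleftrightarrow>
    std_mat A *\<^sub>v std_vec x = std_part \<mu> \<cdot>\<^sub>v std_vec x \<and>
    std_mat A *\<^sub>v dual_vec x + dual_mat A *\<^sub>v std_vec x =
      std_part \<mu> \<cdot>\<^sub>v dual_vec x + dual_part \<mu> \<cdot>\<^sub>v std_vec x"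
    using A x by (auto simp: vec_eq_iff mult_mat_vec_sum[of _ n n] sum.distrib)
  finally show ?thesis .
qed

lemma complex_of_dual_parts:
  "std_mat (map_mat complex_of_dual A) = map_mat complex_of_real (std_mat A)"
  "dual_mat (map_mat complex_of_dual A) = map_mat complex_of_real (dual_mat A)"
  "std_vec (map_vec complex_of_dual x) = map_vec complex_of_real (std_vec x)"
  "dual_vec (map_vec complex_of_dual x) = map_vec complex_of_real (dual_vec x)"
  by (auto simp: dual_num.map_sel intro!: eq_vecI eq_matI)

lemma dual_eigenvector_iff:
  assumes "A \<in> carrier_mat n n"
  shows "dual_eigenvector A x \<mu> \<longleftrightarrow> x \<in> carrier_vec n \<and> std_vec x \<noteq> 0\<^sub>v n \<and>
    std_mat A *\<^sub>v std_vec x = std_part \<mu> \<cdot>\<^sub>v std_vec x \<and>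
    std_mat A *\<^sub>v dual_vec x + dual_mat A *\<^sub>v std_vec x =
      std_part \<mu> \<cdot>\<^sub>v dual_vec x + dual_part \<mu> \<cdot>\<^sub>v std_vec x"
  using dual_mult_mat_vec_eq_smult_iff[OF assms] assms by (auto simp: dual_eigenvector_def)

lemma real_dual_eigenvector_iff:
  assumes A: "A \<in> carrier_mat n n"
  shows "real_dual_eigenvector A x l \<longleftrightarrow> x \<in> carrier_vec n \<and> std_vec x \<noteq> 0\<^sub>v n \<and>
    std_mat A *\<^sub>v std_vec x = std_part l \<cdot>\<^sub>v std_vec x \<and>
    std_mat A *\<^sub>v dual_vec x + dual_mat A *\<^sub>v std_vec x =
      std_part l \<cdot>\<^sub>v dual_vec x + dual_part l \<cdot>\<^sub>v std_vec x"
proof (cases "x \<in> carrier_vec n")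
  case x: True
  have inj: "map_vec complex_of_real u = map_vec complex_of_real v \<longleftrightarrow> u = v" for u v
    by (auto dest: of_real_hom.vec_hom_inj)
  have add: "map_vec complex_of_real (u + v) = map_vec complex_of_real u + map_vec complex_of_real v"
    if "u \<in> carrier_vec n" "v \<in> carrier_vec n" for u v
    using that by (intro eq_vecI) auto
  have mult: "map_vec complex_of_real (map_mat f A *\<^sub>v v) =
      map_mat complex_of_real (map_mat f A) *\<^sub>v map_vec complex_of_real v"
    if "v \<in> carrier_vec n" for f v
    using that A of_real_hom.mult_mat_vec_hom[of "map_mat f A" n n v] by simp
  have std: "map_mat complex_of_real (std_mat A) *\<^sub>v map_vec complex_of_real (std_vec x) =
      of_real (std_part l) \<cdot>\<^sub>v map_vec complex_of_real (std_vec x) \<longleftrightarrow>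
      std_mat A *\<^sub>v std_vec x = std_part l \<cdot>\<^sub>v std_vec x"
    using x unfolding inj[symmetric] by (simp add: mult of_real_hom.vec_hom_smult)
  have dual: "map_mat complex_of_real (std_mat A) *\<^sub>v map_vec complex_of_real (dual_vec x) +
      map_mat complex_of_real (dual_mat A) *\<^sub>v map_vec complex_of_real (std_vec x) =
      of_real (std_part l) \<cdot>\<^sub>v map_vec complex_of_real (dual_vec x) +
      of_real (dual_part l) \<cdot>\<^sub>v map_vec complex_of_real (std_vec x) \<longleftrightarrow>
      std_mat A *\<^sub>v dual_vec x + dual_mat A *\<^sub>v std_vec x =
      std_part l \<cdot>\<^sub>v dual_vec x + dual_part l \<cdot>\<^sub>v std_vec x"
    using x A unfolding inj[symmetric]
    by (simp add: add mult of_real_hom.vec_hom_smult mult_mat_vec_carrier[of _ n n])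
  have zero: "map_vec complex_of_real (std_vec x) = 0\<^sub>v n \<longleftrightarrow> std_vec x = 0\<^sub>v n"
    using x by (auto simp: vec_eq_iff)
  have "map_mat complex_of_dual A \<in> carrier_mat n n" using A by simp
  from dual_eigenvector_iff[OF this] show ?thesis
    using x unfolding real_dual_eigenvector_def
    by (simp add: complex_of_dual_parts dual_num.map_sel std dual zero)
next
  case False
  then show ?thesis using A by (auto simp: real_dual_eigenvector_def dual_eigenvector_def)
qed

lemma dual_norm2_eq_1_iff:
  "dual_norm2 x = 1 \<longleftrightarrow> std_vec x \<bullet> std_vec x = 1 \<and> std_vec x \<bullet> dual_vec x = 0"
  by (auto simp: dual_norm2_def one_dual_num_def)

lemma mk_dual_vec_parts:
  assumes "u \<in> carrier_vec n" "v \<in> carrier_vec n"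
  shows "std_vec (mk_dual_vec u v) = u" "dual_vec (mk_dual_vec u v) = v"
    "mk_dual_vec u v \<in> carrier_vec n"
  using assms by (auto simp: mk_dual_vec_def intro!: eq_vecI)

lemma dual_vec_eqI:
  assumes "std_vec u = std_vec v" "dual_vec u = dual_vec v"
  shows "u = v"
  using assms by (auto simp: vec_eq_iff intro!: dual_num.expand)

lemma shifted_equation_iff:
  fixes S D :: "real mat"
  assumes "S \<in> carrier_mat n n" "D \<in> carrier_mat n n" "w \<in> carrier_vec n" "v \<in> carrier_vec n"
  shows "(S - r \<cdot>\<^sub>m 1\<^sub>m n) *\<^sub>v w = (d \<cdot>\<^sub>m 1\<^sub>m n - D) *\<^sub>v v \<longleftrightarrow>
    S *\<^sub>v w + D *\<^sub>v v = r \<cdot>\<^sub>v w + d \<cdot>\<^sub>v v"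
proof -
  have one: "(c \<cdot>\<^sub>m 1\<^sub>m n) *\<^sub>v u = c \<cdot>\<^sub>v u" if "u \<in> carrier_vec n" for c and u :: "real vec"
    using that by (intro eq_vecI) (auto simp: index_mult_mat_vec)
  have "(S - r \<cdot>\<^sub>m 1\<^sub>m n) *\<^sub>v w = S *\<^sub>v w - r \<cdot>\<^sub>v w"
    "(d \<cdot>\<^sub>m 1\<^sub>m n - D) *\<^sub>v v = d \<cdot>\<^sub>v v - D *\<^sub>v v"
    using assms by (simp_all add: minus_mult_distrib_mat_vec[of _ n n] one)
  moreover have "a - b = c - e \<longleftrightarrow> a + e = b + c" for a b c e :: real by linarith
  ultimately show ?thesis using assms by (simp add: vec_eq_iff)
qed

text \<open>
  A lexicographic form of the fact that a weighted mean is at most the largest value. If all \<open>r i\<close>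
  were below \<open>l\<close>, no standard part would exceed that of \<open>l\<close>, and since they average to it they would
  all be equal to it; then the dual parts, all below that of \<open>l\<close>, could not average to it.
\<close>

lemma dual_weighted_mean_bound:
  fixes l :: "real dual_num" and r :: "nat \<Rightarrow> real dual_num"
  assumes n: "0 < n" and y: "\<And>i. i < n \<Longrightarrow> 0 < y i"
    and std: "(\<Sum>i<n. y i * (std_part (r i) - std_part l)) = 0"
    and dual: "(\<And>i. i < n \<Longrightarrow> std_part (r i) = std_part l) \<Longrightarrow>
      (\<Sum>i<n. y i * (dual_part (r i) - dual_part l)) = 0"
  shows "\<exists>i<n. l \<le> r i"
proof (rule ccontr)
  assume "\<not> ?thesis"
  then have less: "r i < l" if "i < n" for i using that by (meson not_le)
  have le: "y i * (std_part (r i) - std_part l) \<le> 0" if "i < n" for i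
    using less[OF that] y[OF that] by (auto simp: less_dual_num_def mult_le_0_iff)
  have sum0: "(\<Sum>i<n. - (y i * (std_part (r i) - std_part l))) = 0" using std by (simp add: sum_negf)
  have eq: "std_part (r i) = std_part l" if "i < n" for i
  proof -
    have "- (y i * (std_part (r i) - std_part l)) = 0"
      using sum_nonneg_0[OF finite_lessThan _ sum0] le that by auto
    then show ?thesis using y[OF that] by simp
  qed
  then have "y i * (dual_part (r i) - dual_part l) < 0" if "i < n" for i
    using less[OF that] y[OF that] that by (auto simp: less_dual_num_def mult_less_0_iff)
  then have "(\<Sum>i<n. y i * (dual_part (r i) - dual_part l)) < 0"
    using n by (intro sum_strict_mono[of "{..<n}" _ "\<lambda>_. 0 :: real", simplified]) auto
  with dual[OF eq] show False by simp
qed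

section \<open>Perron's theorem for primitive dual number matrices\<close>

theorem theorem4p1:
  fixes n :: nat and A :: "real dual_num mat"
  assumes "n > 0"
    and "A \<in> carrier_mat n n"
    and "primitive_mat (std_mat A)"
  shows "\<exists>l :: real dual_num.
    0 < l \<and> 0 < std_part l \<and>
    (\<exists>x. real_dual_eigenvector A x l \<and> positive_vec (std_vec x)) \<and>
    \<comment> \<open>(a)\<close>
    std_part l = perron_eigenvalue (std_mat A) \<and>
    order (std_part l) (char_poly (std_mat A)) = 1 \<and>
    (\<forall>\<mu>. dual_eigenvalue (map_mat complex_of_dual A) \<mu> \<and> \<mu> \<noteq> complex_of_dual l \<longrightarrow>
       cmod (std_part \<mu>) < std_part l) \<and>
    \<comment> \<open>(b)\<close>
    (\<forall>x. real_dual_eigenvector A x l \<and> positive_vec (std_vec x) \<longrightarrow>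
       perron_eigenvector (std_mat A) (std_vec x)) \<and>
    (\<forall>\<mu> z. dual_eigenvector (map_mat complex_of_dual A) z \<mu> \<and> \<mu> \<noteq> complex_of_dual l \<longrightarrow>
       \<not> (\<forall>i < n. std_vec z $ i \<in> \<real>\<^sub>\<ge>\<^sub>0)) \<and>
    \<comment> \<open>(c)\<close>
    (\<exists>y. perron_eigenvector (transpose_mat (std_mat A)) y) \<and>
    (\<forall>x y. real_dual_eigenvector A x l \<and> positive_vec (std_vec x) \<and>
         perron_eigenvector (transpose_mat (std_mat A)) y \<longrightarrow>
       0 < y \<bullet> std_vec x \<and>
       dual_part l = (y \<bullet> (dual_mat A *\<^sub>v std_vec x)) / (y \<bullet> std_vec x)) \<and>
    (nonneg_mat (dual_mat A) \<longrightarrow> 0 \<le> dual_part l) \<and>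
    (nonneg_mat (dual_mat A) \<and> dual_mat A \<noteq> 0\<^sub>m n n \<longrightarrow> 0 < dual_part l) \<and>
    \<comment> \<open>(d)\<close>
    (\<forall>x. real_dual_eigenvector A x l \<and> positive_vec (std_vec x) \<longrightarrow>
       (std_mat A - std_part l \<cdot>\<^sub>m 1\<^sub>m n) *\<^sub>v dual_vec x =
         (dual_part l \<cdot>\<^sub>m 1\<^sub>m n - dual_mat A) *\<^sub>v std_vec x \<and>
       (dual_norm2 x = 1 \<longrightarrow>
         (\<forall>w \<in> carrier_vec n.
            (std_mat A - std_part l \<cdot>\<^sub>m 1\<^sub>m n) *\<^sub>v w =
              (dual_part l \<cdot>\<^sub>m 1\<^sub>m n - dual_mat A) *\<^sub>v std_vec x \<and>
            dual_norm2 (mk_dual_vec (std_vec x) w) = 1 \<longrightarrow> w = dual_vec x))) \<and>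
    (\<exists>!x. real_dual_eigenvector A x l \<and> positive_vec (std_vec x) \<and> dual_norm2 x = 1) \<and>
    \<comment> \<open>row sum bounds\<close>
    Min ((\<lambda>i. \<Sum>j<n. A $$ (i, j)) ` {..<n}) \<le> l \<and>
    l \<le> Max ((\<lambda>i. \<Sum>j<n. A $$ (i, j)) ` {..<n})"
proof -
  define S where "S = std_mat A"
  define D where "D = dual_mat A"
  note n = assms(1) and A = assms(2)
  have S: "S \<in> carrier_mat n n" and D: "D \<in> carrier_mat n n" and prim: "primitive_mat S"
    using assms by (auto simp: S_def D_def)
  have AC: "map_mat complex_of_dual A \<in> carrier_mat n n" using A by simp
  let ?\<rho> = "perron_eigenvalue S"
  note real_iff = real_dual_eigenvector_iff[OF A, folded S_def D_def]
  obtain x where x: "perron_eigenvector S x" using perron_eigenvector_exists[OF S n prim] by blast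
  have ST: "transpose_mat S \<in> carrier_mat n n" using S by simp
  obtain y where y: "perron_eigenvector (transpose_mat S) y"
    using perron_eigenvector_exists[OF ST n primitive_transpose[OF S prim]] by blast
  note perron = S n prim
  note xD = perron_eigenvectorD[OF perron x]
  have yc: "y \<in> carrier_vec n" by (rule perron_vec_carrier(2)[OF perron x y])
  have ypos: "0 < y $ i" if "i < n" for i
    using y yc that by (auto simp: perron_eigenvector_def positive_vec_def)
  have yx: "0 < y \<bullet> x" by (rule left_right_perron_pos[OF perron x y])
  define l where "l = Dual ?\<rho> (y \<bullet> (D *\<^sub>v x) / (y \<bullet> x))"
  have l: "std_part l = ?\<rho>" "dual_part l * (y \<bullet> x) = y \<bullet> (D *\<^sub>v x)"
    using yx by (simp_all add: l_def)

  have "0 < std_part l" using perron_eigenvalue_pos[OF perron] l by simp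
  then have "0 < l" by (simp add: less_dual_num_def zero_dual_num_def)

  have b1: "perron_eigenvector S (std_vec u)" if "real_dual_eigenvector A u l" "positive_vec (std_vec u)" for u
    using that S real_iff l(1) by (auto simp: perron_eigenvector_def eigenvector_def)

  have simple: "order (std_part l) (char_poly S) = 1"
    unfolding l(1) by (rule perron_eigenvalue_simple[OF perron x y])

  \<comment> \<open>Any eigenvalue with standard part \<open>\<rho>\<close> has the dual part forced by \<open>y\<close>, hence is \<open>l\<close>.\<close>
  have other: "std_part \<mu> \<noteq> of_real ?\<rho>"
    if z: "dual_eigenvector (map_mat complex_of_dual A) z \<mu>" and \<mu>: "\<mu> \<noteq> complex_of_dual l" for \<mu> z
  proof
    assume eq: "std_part \<mu> = of_real ?\<rho>"
    have zc: "z \<in> carrier_vec n" "std_vec z \<noteq> 0\<^sub>v n"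
      and e1: "map_mat complex_of_real S *\<^sub>v std_vec z = of_real ?\<rho> \<cdot>\<^sub>v std_vec z"
      and e2: "map_mat complex_of_real S *\<^sub>v dual_vec z + map_mat complex_of_real D *\<^sub>v std_vec z =
        of_real ?\<rho> \<cdot>\<^sub>v dual_vec z + dual_part \<mu> \<cdot>\<^sub>v std_vec z"
      using z[unfolded dual_eigenvector_iff[OF AC] complex_of_dual_parts, folded S_def D_def] eq by auto
    obtain c where c: "std_vec z = c \<cdot>\<^sub>v map_vec complex_of_real x"
      using perron_eigenspace_complex[OF perron x _ e1] zc by auto
    have c0: "c \<noteq> 0" using c zc(2) xD(1) by auto
    have "map_mat complex_of_real D *\<^sub>v std_vec z = c \<cdot>\<^sub>v map_vec complex_of_real (D *\<^sub>v x)"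
      unfolding c using D xD(1) of_real_hom.mult_mat_vec_hom[OF D xD(1), where ?'a = complex]
      by (simp add: mult_mat_vec[of _ n n])
    from e2[unfolded this, unfolded c]
    have "of_real (y \<bullet> (D *\<^sub>v x)) = dual_part \<mu> * complex_of_real (y \<bullet> x)"
      using dual_part_of_complex_perron_eigenvector[OF perron x y, of "dual_vec z" "D *\<^sub>v x" c "dual_part \<mu>"]
        zc(1) D xD(1) c0 by simp
    then have "dual_part \<mu> * complex_of_real (y \<bullet> x) = of_real (dual_part l) * complex_of_real (y \<bullet> x)"
      using l(2) by (metis of_real_mult)
    then have "dual_part \<mu> = of_real (dual_part l)" using yx by simp
    with eq l(1) have "\<mu> = complex_of_dual l" by (simp add: dual_num.expand dual_num.map_sel)
    with \<mu> show False by simp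
  qed

  have a: "cmod (std_part \<mu>) < std_part l"
    if ev: "dual_eigenvalue (map_mat complex_of_dual A) \<mu>" and \<mu>: "\<mu> \<noteq> complex_of_dual l" for \<mu>
  proof -
    obtain z where z: "dual_eigenvector (map_mat complex_of_dual A) z \<mu>"
      using ev by (auto simp: dual_eigenvalue_def)
    have "eigenvector (map_mat complex_of_real S) (std_vec z) (std_part \<mu>)"
      using z[unfolded dual_eigenvector_iff[OF AC] complex_of_dual_parts, folded S_def D_def] S
      by (auto simp: eigenvector_def)
    then have "eigenvalue (map_mat complex_of_real S) (std_part \<mu>)" by (auto simp: eigenvalue_def)
    from perron_eigenvalue_dominant[OF perron this] other[OF z \<mu>] l(1) show ?thesis by simp
  qed

  \<comment> \<open>A nonnegative \<open>z\<^sub>s\<close> is not orthogonal to \<open>y\<close>, which forces the standard part of \<open>\<mu>\<close> to be \<open>\<rho>\<close>.\<close>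
  have b2: "\<not> (\<forall>i<n. std_vec z $ i \<in> \<real>\<^sub>\<ge>\<^sub>0)"
    if z: "dual_eigenvector (map_mat complex_of_dual A) z \<mu>" and \<mu>: "\<mu> \<noteq> complex_of_dual l" for \<mu> z
  proof
    assume nn: "\<forall>i<n. std_vec z $ i \<in> \<real>\<^sub>\<ge>\<^sub>0"
    have zc: "z \<in> carrier_vec n" "std_vec z \<noteq> 0\<^sub>v n"
      and e1: "map_mat complex_of_real S *\<^sub>v std_vec z = std_part \<mu> \<cdot>\<^sub>v std_vec z"
      using z[unfolded dual_eigenvector_iff[OF AC] complex_of_dual_parts, folded S_def D_def] by auto
    define v where "v = map_vec Re (std_vec z)"
    have v: "v \<in> carrier_vec n" "\<And>i. i < n \<Longrightarrow> 0 \<le> v $ i"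
      using zc nn by (auto simp: v_def complex_nonneg_Reals_iff)
    have zv: "std_vec z = map_vec complex_of_real v"
      using zc nn by (auto simp: v_def complex_nonneg_Reals_iff complex_eq_iff intro!: eq_vecI)
    have "v \<noteq> 0\<^sub>v n" using zc zv by auto
    then have yv: "0 < y \<bullet> v"
      using y yc v by (intro scalar_prod_positive[of y n v]) (auto simp: perron_eigenvector_def)
    have "of_real ?\<rho> * (map_vec complex_of_real y \<bullet> std_vec z) = std_part \<mu> * (map_vec complex_of_real y \<bullet> std_vec z)"
      using scalar_prod_left_perron_complex[OF perron x y, of "std_vec z"] zc(1) yc unfolding e1 by auto
    then have "of_real ?\<rho> * complex_of_real (y \<bullet> v) = std_part \<mu> * of_real (y \<bullet> v)"
      unfolding zv using yc v by (simp add: scalar_prod_of_real)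
    then have "std_part \<mu> = of_real ?\<rho>" using yv by simp
    with other[OF z \<mu>] show False by simp
  qed

  have c: "0 < y' \<bullet> std_vec u \<and> dual_part l = y' \<bullet> (D *\<^sub>v std_vec u) / (y' \<bullet> std_vec u)"
    if u: "real_dual_eigenvector A u l" "positive_vec (std_vec u)"
      and y': "perron_eigenvector (transpose_mat S) y'" for u y'
  proof -
    note pu = b1[OF u]
    have "0 < y' \<bullet> std_vec u" by (rule left_right_perron_pos[OF perron pu y'])
    moreover have "y' \<bullet> (D *\<^sub>v std_vec u) = dual_part l * (y' \<bullet> std_vec u)"
      using u(1)[unfolded real_iff] D l(1)
      by (intro dual_part_of_perron_eigenvector[OF perron pu y', of "dual_vec u"]) auto
    ultimately show ?thesis by simp
  qed

  have Dx: "D *\<^sub>v x \<in> carrier_vec n" using D xD(1) by simp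
  have Dx_nonneg: "0 \<le> (D *\<^sub>v x) $ i" if "nonneg_mat D" "i < n" for i
    using that D xD by (auto simp: mult_mat_vec_sum[of _ n n] nonneg_mat_def less_imp_le intro!: sum_nonneg)
  have nonneg: "0 \<le> dual_part l" if "nonneg_mat D"
  proof -
    have "0 \<le> y \<bullet> (D *\<^sub>v x)"
      unfolding scalar_prod_sum[OF Dx]
      using ypos Dx_nonneg[OF that] by (intro sum_nonneg) (auto simp: less_imp_le)
    then show ?thesis using yx by (simp add: l_def)
  qed
  have pos: "0 < dual_part l" if nn: "nonneg_mat D" and nz: "D \<noteq> 0\<^sub>m n n"
  proof -
    obtain i j where ij: "i < n" "j < n" "D $$ (i, j) \<noteq> 0"
      using nz D by (auto simp: mat_eq_iff)
    then have "0 < D $$ (i, j) * x $ j" using nn D xD(3) by (auto simp: nonneg_mat_def order_less_le)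
    also have "\<dots> \<le> (\<Sum>j<n. D $$ (i, j) * x $ j)"
      using nn D xD ij by (intro member_le_sum) (auto simp: nonneg_mat_def less_imp_le)
    also have "\<dots> = (D *\<^sub>v x) $ i" using D xD(1) ij by (simp add: mult_mat_vec_sum[of _ n n])
    finally have "D *\<^sub>v x \<noteq> 0\<^sub>v n" using ij by auto
    then have "0 < y \<bullet> (D *\<^sub>v x)"
      using y yc Dx Dx_nonneg[OF nn]
      by (intro scalar_prod_positive[of y n]) (auto simp: perron_eigenvector_def)
    then show ?thesis using yx by (simp add: l_def)
  qed

  note shifted = shifted_equation_iff[OF S D]
  have unique: "w = dual_vec u"
    if u: "real_dual_eigenvector A u l" "positive_vec (std_vec u)" "dual_norm2 u = 1"
      and w: "w \<in> carrier_vec n" "std_vec u \<bullet> w = 0"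
        "S *\<^sub>v w + D *\<^sub>v std_vec u = std_part l \<cdot>\<^sub>v w + dual_part l \<cdot>\<^sub>v std_vec u" for u w
  proof (rule perron_equation_unique_orthogonal[OF perron b1[OF u(1,2)] y w(1) _ w(2)])
    show "S *\<^sub>v w + D *\<^sub>v std_vec u = ?\<rho> \<cdot>\<^sub>v w + dual_part l \<cdot>\<^sub>v std_vec u"
      "S *\<^sub>v dual_vec u + D *\<^sub>v std_vec u = ?\<rho> \<cdot>\<^sub>v dual_vec u + dual_part l \<cdot>\<^sub>v std_vec u"
      using w(3) u(1) l(1) by (simp_all add: real_iff)
  qed (use u D real_iff in \<open>auto simp: dual_norm2_eq_1_iff\<close>)

  have d: "(S - std_part l \<cdot>\<^sub>m 1\<^sub>m n) *\<^sub>v dual_vec u = (dual_part l \<cdot>\<^sub>m 1\<^sub>m n - D) *\<^sub>v std_vec u \<and>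
       (dual_norm2 u = 1 \<longrightarrow>
         (\<forall>w \<in> carrier_vec n.
            (S - std_part l \<cdot>\<^sub>m 1\<^sub>m n) *\<^sub>v w = (dual_part l \<cdot>\<^sub>m 1\<^sub>m n - D) *\<^sub>v std_vec u \<and>
            dual_norm2 (mk_dual_vec (std_vec u) w) = 1 \<longrightarrow> w = dual_vec u))"
    if u: "real_dual_eigenvector A u l" "positive_vec (std_vec u)" for u
  proof -
    have uc: "std_vec u \<in> carrier_vec n" "dual_vec u \<in> carrier_vec n" using u(1) by (auto simp: real_iff)
    have "(S - std_part l \<cdot>\<^sub>m 1\<^sub>m n) *\<^sub>v dual_vec u = (dual_part l \<cdot>\<^sub>m 1\<^sub>m n - D) *\<^sub>v std_vec u"
      using u(1) unfolding shifted[OF uc(2,1)] by (simp add: real_iff)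
    moreover have "w = dual_vec u"
      if "dual_norm2 u = 1" "w \<in> carrier_vec n" "dual_norm2 (mk_dual_vec (std_vec u) w) = 1"
        "(S - std_part l \<cdot>\<^sub>m 1\<^sub>m n) *\<^sub>v w = (dual_part l \<cdot>\<^sub>m 1\<^sub>m n - D) *\<^sub>v std_vec u" for w
      using that unique[OF u that(1,2)] shifted[OF that(2) uc(1)] mk_dual_vec_parts[OF uc(1) that(2)]
      by (simp add: dual_norm2_eq_1_iff)
    ultimately show ?thesis by blast
  qed

  have xx: "0 < x \<bullet> x"
    using xD x by (intro scalar_prod_positive[of x n]) (auto simp: perron_eigenvector_def less_imp_le)
  define u where "u = (1 / sqrt (x \<bullet> x)) \<cdot>\<^sub>v x"
  have u: "u \<in> carrier_vec n" "\<And>i. i < n \<Longrightarrow> 0 < u $ i" "u \<bullet> u = 1"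
    using xD xx by (auto simp: u_def power2_eq_square[symmetric] field_simps)
  have "u \<noteq> 0\<^sub>v n" using u n by auto
  moreover have Su: "S *\<^sub>v u = ?\<rho> \<cdot>\<^sub>v u"
    using S xD by (simp add: u_def mult_mat_vec[of _ n n] smult_smult_assoc mult.commute)
  ultimately have pu: "perron_eigenvector S u"
    using u S by (auto simp: perron_eigenvector_def eigenvector_def positive_vec_def)
  \<comment> \<open>The right-hand side is orthogonal to \<open>y\<close> by the choice of the dual part of \<open>l\<close>.\<close>
  define b where "b = dual_part l \<cdot>\<^sub>v u - D *\<^sub>v u"
  have b: "b \<in> carrier_vec n" using u D by (simp add: b_def)
  have "y \<bullet> (D *\<^sub>v u) = dual_part l * (y \<bullet> u)"
    using l(2) xD(1) yc Dx by (simp add: u_def mult_mat_vec[OF D])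
  then have "y \<bullet> b = 0"
    using yc u D by (simp add: b_def scalar_prod_minus_distrib[of _ n])
  then obtain w0 where w0: "w0 \<in> carrier_vec n" "S *\<^sub>v w0 - ?\<rho> \<cdot>\<^sub>v w0 = b"
    using perron_fredholm[OF perron pu y b] by blast
  \<comment> \<open>Removing the component along \<open>u\<close> keeps the equation and makes \<open>w\<close> orthogonal to \<open>u\<close>.\<close>
  define w where "w = w0 - (u \<bullet> w0) \<cdot>\<^sub>v u"
  have w: "w \<in> carrier_vec n" "u \<bullet> w = 0"
    using u w0 by (simp_all add: w_def scalar_prod_minus_distrib[of _ n])
  have "(S *\<^sub>v w) $ i + (D *\<^sub>v u) $ i = ?\<rho> * w $ i + dual_part l * u $ i" if "i < n" for i
    using arg_cong[OF w0(2), of "\<lambda>v. v $ i"] that w0(1) u(1) S D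
    by (simp add: w_def b_def mult_minus_distrib_mat_vec[of _ n n] mult_mat_vec[of _ n n] Su algebra_simps)
  then have weq: "S *\<^sub>v w + D *\<^sub>v u = ?\<rho> \<cdot>\<^sub>v w + dual_part l \<cdot>\<^sub>v u"
    using w u S D by (intro eq_vecI) auto
  define X where "X = mk_dual_vec u w"
  note Xp = mk_dual_vec_parts[OF u(1) w(1), folded X_def]
  have X: "real_dual_eigenvector A X l" "positive_vec (std_vec X)" "dual_norm2 X = 1"
    using Xp Su weq u w l(1) \<open>u \<noteq> 0\<^sub>v n\<close>
    by (simp_all add: real_iff positive_vec_def dual_norm2_eq_1_iff)
  have X_unique: "X' = X"
    if X': "real_dual_eigenvector A X' l" "positive_vec (std_vec X')" "dual_norm2 X' = 1" for X'
  proof -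
    note p = perron_eigenvectorD[OF perron b1[OF X'(1,2)]]
    obtain c where c: "std_vec X' = c \<cdot>\<^sub>v u"
      using perron_eigenspace_real[OF perron pu p(1,2)] by blast
    have "0 < c" using p(3)[OF n] u(1) u(2)[OF n] n unfolding c by (simp add: zero_less_mult_iff)
    moreover have "c * c = 1" using X'(3) u unfolding dual_norm2_eq_1_iff c by simp
    ultimately have "c = 1" by (simp add: square_eq_1_iff)
    then have std: "std_vec X' = std_vec X" using c Xp u by simp
    have "dual_vec X' = dual_vec X"
    proof (rule unique[OF X])
      show "dual_vec X' \<in> carrier_vec n" "std_vec X \<bullet> dual_vec X' = 0"
        "S *\<^sub>v dual_vec X' + D *\<^sub>v std_vec X = std_part l \<cdot>\<^sub>v dual_vec X' + dual_part l \<cdot>\<^sub>v std_vec X"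
        using X' unfolding std[symmetric] by (auto simp: real_iff dual_norm2_eq_1_iff)
    qed
    with std show ?thesis by (rule dual_vec_eqI)
  qed

  define r where "r i = (\<Sum>j<n. A $$ (i, j))" for i
  define e :: "real vec" where "e = vec n (\<lambda>_. 1)"
  have e: "e \<in> carrier_vec n" by (simp add: e_def)
  have r: "std_part (r i) = (S *\<^sub>v e) $ i" "dual_part (r i) = (D *\<^sub>v e) $ i" if "i < n" for i
    using that A e by (simp_all add: r_def std_part_sum dual_part_sum S_def D_def mult_mat_vec_sum[of _ n n] e_def)
  have rsum: "(\<Sum>i<n. y $ i * (std_part (r i) - std_part l)) = 0"
  proof -
    have "(\<Sum>i<n. y $ i * (std_part (r i) - std_part l)) = y \<bullet> (S *\<^sub>v e) - ?\<rho> * (y \<bullet> e)"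
      using S e r l(1)
      by (simp add: scalar_prod_sum[of _ n] right_diff_distrib sum_subtractf sum_distrib_left e_def mult.commute)
    then show ?thesis using scalar_prod_left_perron_real[OF perron x y e] by simp
  qed
  \<comment> \<open>Equal row sums of \<open>S\<close> make the all-ones vector a multiple of \<open>x\<close>.\<close>
  have dsum: "(\<Sum>i<n. y $ i * (dual_part (r i) - dual_part l)) = 0"
    if const: "\<And>i. i < n \<Longrightarrow> std_part (r i) = std_part l"
  proof -
    have "S *\<^sub>v e = ?\<rho> \<cdot>\<^sub>v e" using const r S e l(1) by (intro eq_vecI) (auto simp: e_def)
    then obtain c where c: "e = c \<cdot>\<^sub>v x" using perron_eigenspace_real[OF perron x e] by blast
    have "y \<bullet> (D *\<^sub>v e) = dual_part l * (y \<bullet> e)"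
      unfolding c using l(2) xD(1) yc Dx by (simp add: mult_mat_vec[OF D])
    moreover have "(\<Sum>i<n. y $ i * (dual_part (r i) - dual_part l)) = y \<bullet> (D *\<^sub>v e) - dual_part l * (y \<bullet> e)"
      using D e r
      by (simp add: scalar_prod_sum[of _ n] right_diff_distrib sum_subtractf sum_distrib_left e_def mult.commute)
    ultimately show ?thesis by simp
  qed
  obtain i where i: "i < n" "l \<le> r i"
    using dual_weighted_mean_bound[OF n ypos rsum dsum] by blast
  \<comment> \<open>The lower bound is the upper bound for the negated row sums.\<close>
  have "\<exists>k<n. - l \<le> - r k"
  proof (rule dual_weighted_mean_bound[where y = "\<lambda>i. y $ i", OF n ypos])
    show "(\<Sum>i<n. y $ i * (std_part (- r i) - std_part (- l))) = 0"
      using rsum by (simp add: uminus_dual_num_def right_diff_distrib sum_subtractf)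
    show "(\<Sum>i<n. y $ i * (dual_part (- r i) - dual_part (- l))) = 0"
      if "\<And>i. i < n \<Longrightarrow> std_part (- r i) = std_part (- l)"
      using dsum that by (simp add: uminus_dual_num_def right_diff_distrib sum_subtractf)
  qed
  then obtain k where k: "k < n" "- l \<le> - r k" by blast
  have "r k \<le> l" using k(2) by (auto simp: less_eq_dual_num_def uminus_dual_num_def)
  have bounds: "Min (r ` {..<n}) \<le> l" "l \<le> Max (r ` {..<n})"
  proof -
    have "Min (r ` {..<n}) \<le> r k" using k(1) by (intro Min_le) auto
    with \<open>r k \<le> l\<close> show "Min (r ` {..<n}) \<le> l" by (rule order_trans[rotated])
    have "r i \<le> Max (r ` {..<n})" using i(1) by (intro Max_ge) auto
    with i(2) show "l \<le> Max (r ` {..<n})" by (rule order_trans)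
  qed

  show ?thesis
    unfolding S_def[symmetric] D_def[symmetric] r_def[symmetric]
  proof (intro exI[of _ l] conjI allI impI)
    show "\<exists>!x. real_dual_eigenvector A x l \<and> positive_vec (std_vec x) \<and> dual_norm2 x = 1"
      using X X_unique by blast
    show "Min (r ` {..<n}) \<le> l" "l \<le> Max (r ` {..<n})" by (rule bounds)+
  qed (use \<open>0 < l\<close> \<open>0 < std_part l\<close> X l(1) simple a b1 b2 y c nonneg pos d in blast)+
qed

end
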